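(* Let $R<\frac{\pi}{2}$ be a real number, let $m\in\mathbb{C}$ with $|m|\leq 1$, and let $z\in\mathbb{C}$ with $|z|\leq R$. Put $m_1:=1-|m|\in[0,1]$. Then the following inequalities hold: \[ \text{(i)}\quad |\operatorname{sn}(z,m)|\leq\frac{\operatorname{sn}(|z|,m_1)}{\operatorname{cn}(|z|,m_1)}\leq\tan|z|, \] \[ \text{(ii)}\quad |\operatorname{cn}(z,m)|\leq\frac{1}{\operatorname{cn}(|z|,m_1)}\leq\frac{1}{\cos|z|}, \] \[ \text{(iii)}\quad |\operatorname{dn}(z,m)|\leq\frac{\operatorname{dn}(|z|,m_1)}{\operatorname{cn}(|z|,m_1)}\leq\frac{1}{\cos|z|}. \] In all of these inequalities (both the first and the second one in each of (i), (ii), (iii)) equality holds if $z=0$, or if $m=1$ and $z=\mathrm{i}y$ with $y\in\mathbb{R}$, $-R\leq y\leq R$. Further, in the first inequality of each of (i), (ii), (iii), equality is attained if $z=\mathrm{i}y$ with $y\in\mathbb{R}$, $-R\leq y\leq R$, and $m=|m|$ (that is, $m$ is real and $m\in[0,1]$).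
   Context: Here $\operatorname{sn}(z,m)$, $\operatorname{cn}(z,m)$, $\operatorname{dn}(z,m)$ denote the Jacobian elliptic functions of the complex variable $z$, written in terms of the complex parameter $m=k^2$, where $k\in\mathbb{C}$ is the modulus (the functions depend only on $k^2$). That is, for fixed $m\in\mathbb{C}$ they are the meromorphic functions of $z\in\mathbb{C}$ determined by the system (with $'$ denoting $d/dz$) \[ \operatorname{sn}'=\operatorname{cn}\,\operatorname{dn},\qquad \operatorname{cn}'=-\operatorname{sn}\,\operatorname{dn},\qquad \operatorname{dn}'=-m\,\operatorname{sn}\,\operatorname{cn}, \] with initial values $\operatorname{sn}(0,m)=0$, $\operatorname{cn}(0,m)=1$, $\operatorname{dn}(0,m)=1$. In the degenerate cases, $\operatorname{sn}(z,0)=\sin z$, $\operatorname{cn}(z,0)=\cos z$, $\operatorname{dn}(z,0)=1$, and $\operatorname{sn}(z,1)=\tanh z$, $\operatorname{cn}(z,1)=\operatorname{dn}(z,1)=1/\cosh z$. The symbol $\mathrm{i}$ denotes the imaginary unit. *)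

theory Defs
  imports "HOL-Complex_Analysis.Complex_Analysis"
begin

text \<open>
  The three functions are defined simultaneously, as the meromorphic solution on the whole plane of
  the Jacobian system with parameter \<open>m = k\<^sup>2\<close>. Two meromorphic functions are identified when they
  agree off their poles. To have a unique representative we use the library's convention that a
  function has no removable singularities and takes the value 0 at its poles. Since that value alone
  does not exclude a pole at the origin, analyticity there is demanded along with the initial values.
\<close>

definition jacobi_system ::
    "complex \<Rightarrow> (complex \<Rightarrow> complex) \<Rightarrow> (complex \<Rightarrow> complex) \<Rightarrow> (complex \<Rightarrow> complex) \<Rightarrow> bool" where
  "jacobi_system m s c d \<longleftrightarrow>
     s nicely_meromorphic_on UNIV \<and> c nicely_meromorphic_on UNIV \<and> d nicely_meromorphic_on UNIV \<and>
     s analytic_on {0} \<and> c analytic_on {0} \<and> d analytic_on {0} \<and>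
     s 0 = 0 \<and> c 0 = 1 \<and> d 0 = 1 \<and>
     (\<forall>z. \<not> is_pole s z \<and> \<not> is_pole c z \<and> \<not> is_pole d z \<longrightarrow>
        (s has_field_derivative c z * d z) (at z) \<and>
        (c has_field_derivative - (s z * d z)) (at z) \<and>
        (d has_field_derivative - (m * s z * c z)) (at z))"

definition jacobi_sn :: "complex \<Rightarrow> complex \<Rightarrow> complex" where
  "jacobi_sn z m = (THE s. \<exists>c d. jacobi_system m s c d) z"

definition jacobi_cn :: "complex \<Rightarrow> complex \<Rightarrow> complex" where
  "jacobi_cn z m = (THE c. \<exists>s d. jacobi_system m s c d) z"

definition jacobi_dn :: "complex \<Rightarrow> complex \<Rightarrow> complex" where
  "jacobi_dn z m = (THE d. \<exists>s c. jacobi_system m s c d) z"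

text \<open>
  With the value 0 at poles, an estimate of \<open>jacobi_sn z m\<close> is only meaningful if \<open>z\<close> is not a pole;
  the following predicate expresses that all three functions are finite at \<open>z\<close>.
\<close>

definition jacobi_finite :: "complex \<Rightarrow> complex \<Rightarrow> bool" where
  "jacobi_finite z m \<longleftrightarrow>
     \<not> is_pole (\<lambda>w. jacobi_sn w m) z \<and>
     \<not> is_pole (\<lambda>w. jacobi_cn w m) z \<and>
     \<not> is_pole (\<lambda>w. jacobi_dn w m) z"

end

theory Submission
  imports Defs
begin

text \<open>
  Consider the system \<open>s' = c d\<close>, \<open>c' = a s d\<close>, \<open>d' = b s c\<close>. The Taylor coefficients of its solution are
  polynomials in \<open>a\<close>, \<open>b\<close> with nonnegative coefficients, so those for \<open>(-1, -m)\<close> are dominated by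
  those for \<open>(1, |m|)\<close>, and these by those for \<open>(1, 1)\<close>, which belong to \<open>tan\<close>, \<open>sec\<close>, \<open>sec\<close>. Everything
  therefore converges for \<open>|z| < \<pi>/2\<close> and the inequalities follow, because by Jacobi's imaginary
  transformation the solution for \<open>(1, |m|)\<close> is \<open>sn/cn\<close>, \<open>1/cn\<close>, \<open>dn/cn\<close> with parameter \<open>1 - |m|\<close>. Equality
  on the imaginary axis holds since replacing \<open>z\<close> by \<open>\<plusminus>\<i>z\<close> turns \<open>(-1, -m)\<close> into \<open>(1, m)\<close>.

  The meromorphic functions on the whole plane come from the duplication formulas: after multiplication
  with a theta function these express \<open>sn\<close>, \<open>cn\<close>, \<open>dn\<close> at \<open>z\<close> polynomially by their values at \<open>z/2\<close>, which
  extends numerators and denominator to entire functions.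
\<close>

subsection \<open>Taylor coefficients\<close>

text \<open>The recursions compare coefficients in the differential system: products become Cauchy
  products, and differentiation contributes the factor \<open>Suc n\<close>. The field is kept
  general so that real coefficients can serve as majorants of complex ones.\<close>

fun sn_coeff cn_coeff dn_coeff :: "'a::real_normed_field \<Rightarrow> 'a \<Rightarrow> nat \<Rightarrow> 'a" where
  "sn_coeff a b 0 = 0"
| "sn_coeff a b (Suc n) = (\<Sum>k\<le>n. cn_coeff a b k * dn_coeff a b (n - k)) / of_nat (Suc n)"
| "cn_coeff a b 0 = 1"
| "cn_coeff a b (Suc n) = a * (\<Sum>k\<le>n. sn_coeff a b k * dn_coeff a b (n - k)) / of_nat (Suc n)"
| "dn_coeff a b 0 = 1"
| "dn_coeff a b (Suc n) = b * (\<Sum>k\<le>n. sn_coeff a b k * cn_coeff a b (n - k)) / of_nat (Suc n)"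

declare sn_coeff.simps(2) [simp del] cn_coeff.simps(2) [simp del] dn_coeff.simps(2) [simp del]
lemmas coeff_Suc = sn_coeff.simps(2) cn_coeff.simps(2) dn_coeff.simps(2)

text \<open>
  The solution of \<open>s' = c d\<close>, \<open>c' = a s d\<close>, \<open>d' = b s c\<close> with \<open>s 0 = 0\<close>, \<open>c 0 = d 0 = 1\<close>. The Jacobian
  functions are the case \<open>a = -1\<close>, \<open>b = -m\<close>, and \<open>a = b = 1\<close> gives \<open>tan\<close>, \<open>sec\<close>, \<open>sec\<close>.
\<close>

definition gsn :: "'a::{banach, real_normed_field} \<Rightarrow> 'a \<Rightarrow> 'a \<Rightarrow> 'a" where
  "gsn a b = eval_fps (Abs_fps (sn_coeff a b))"

definition gcn :: "'a::{banach, real_normed_field} \<Rightarrow> 'a \<Rightarrow> 'a \<Rightarrow> 'a" where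
  "gcn a b = eval_fps (Abs_fps (cn_coeff a b))"

definition gdn :: "'a::{banach, real_normed_field} \<Rightarrow> 'a \<Rightarrow> 'a \<Rightarrow> 'a" where
  "gdn a b = eval_fps (Abs_fps (dn_coeff a b))"

text \<open>The recursions use only sums, products, the parameters and division by positive
  integers, so the triangle inequality carries the bounds through the induction. Nonnegativity of
  the majorants comes along, since each of them lies above a norm.\<close>

lemma norm_coeff_le:
  fixes a b :: "'a::real_normed_field"
  assumes "norm a \<le> A" "norm b \<le> B"
  shows "norm (sn_coeff a b n) \<le> sn_coeff A B n \<and> norm (cn_coeff a b n) \<le> cn_coeff A B n \<and>
         norm (dn_coeff a b n) \<le> dn_coeff A B n"
proof (induction n rule: less_induct)
  case (less n)
  have pos: "0 \<le> A" "0 \<le> B"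
    using assms norm_ge_zero order_trans by blast+
  show ?case
  proof (cases n)
    case (Suc m)
    have IH: "norm (sn_coeff a b k) \<le> sn_coeff A B k" "norm (cn_coeff a b k) \<le> cn_coeff A B k"
      "norm (dn_coeff a b k) \<le> dn_coeff A B k" if "k \<le> m" for k
      using less.IH[of k] that Suc by auto
    have nn: "0 \<le> sn_coeff A B k" "0 \<le> cn_coeff A B k" "0 \<le> dn_coeff A B k" if "k \<le> m" for k
      using IH[OF that] norm_ge_zero order_trans by blast+
    have conv: "norm (\<Sum>k\<le>m. f k * g (m - k)) \<le> (\<Sum>k\<le>m. F k * G (m - k))"
      if "\<And>k. k \<le> m \<Longrightarrow> norm (f k) \<le> F k" "\<And>k. k \<le> m \<Longrightarrow> norm (g k) \<le> G k"
      for f g :: "nat \<Rightarrow> 'a" and F G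
    proof (rule sum_norm_le)
      fix k assume "k \<in> {..m}"
      then have *: "norm (f k) \<le> F k" "norm (g (m - k)) \<le> G (m - k)"
        using that by auto
      show "norm (f k * g (m - k)) \<le> F k * G (m - k)"
        unfolding norm_mult
        by (rule mult_mono[OF *]) (use *(1) norm_ge_zero order_trans in blast)+
    qed
    have n: "norm (of_nat (Suc m) :: 'a) = of_nat (Suc m)"
      by (rule norm_of_nat)
    have "norm (sn_coeff a b n) \<le> sn_coeff A B n"
      unfolding Suc coeff_Suc norm_divide n
      by (intro divide_right_mono conv IH) auto
    moreover have "norm (cn_coeff a b n) \<le> cn_coeff A B n"
      unfolding Suc coeff_Suc norm_divide n norm_mult
      by (intro divide_right_mono mult_mono conv IH assms pos) auto
    moreover have "norm (dn_coeff a b n) \<le> dn_coeff A B n"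
      unfolding Suc coeff_Suc norm_divide n norm_mult
      by (intro divide_right_mono mult_mono conv IH assms pos) auto
    ultimately show ?thesis by blast
  qed auto
qed

lemma of_real_coeff:
  "sn_coeff (of_real a :: 'a::real_normed_field) (of_real b) n = of_real (sn_coeff a b n) \<and>
   cn_coeff (of_real a :: 'a) (of_real b) n = of_real (cn_coeff a b n) \<and>
   dn_coeff (of_real a :: 'a) (of_real b) n = of_real (dn_coeff a b n)"
proof (induction n rule: less_induct)
  case (less n)
  show ?case
    by (cases n) (auto simp: coeff_Suc less.IH simp del: of_nat_Suc)
qed

text \<open>Coefficient form of a substitution: if \<open>s\<close>, \<open>c\<close>,
  \<open>d\<close> solve the system for \<open>(a, b)\<close>, then \<open>s (w * z) / w\<close>,
  \<open>c (w * z)\<close>, \<open>d (w * z)\<close> solve it for \<open>w\<^sup>2 * a\<close> and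
  \<open>w\<^sup>2 * b\<close>.\<close>

lemma coeff_scale:
  fixes w :: "'a::real_normed_field"
  shows "sn_coeff a b n * w ^ n = w * sn_coeff (w\<^sup>2 * a) (w\<^sup>2 * b) n \<and>
   cn_coeff a b n * w ^ n = cn_coeff (w\<^sup>2 * a) (w\<^sup>2 * b) n \<and>
   dn_coeff a b n * w ^ n = dn_coeff (w\<^sup>2 * a) (w\<^sup>2 * b) n"
proof (induction n rule: less_induct)
  case (less n)
  show ?case
  proof (cases n)
    case (Suc m)
    have IH: "sn_coeff a b k * w ^ k = w * sn_coeff (w\<^sup>2 * a) (w\<^sup>2 * b) k"
      "cn_coeff a b k * w ^ k = cn_coeff (w\<^sup>2 * a) (w\<^sup>2 * b) k"
      "dn_coeff a b k * w ^ k = dn_coeff (w\<^sup>2 * a) (w\<^sup>2 * b) k" if "k \<le> m" for k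
      using less.IH[of k] that Suc by auto
    have conv: "(\<Sum>k\<le>m. f k * g (m - k)) * w ^ m = (\<Sum>k\<le>m. (f k * w ^ k) * (g (m - k) * w ^ (m - k)))"
      for f g :: "nat \<Rightarrow> 'a"
      unfolding sum_distrib_right
    proof (rule sum.cong)
      fix k assume "k \<in> {..m}"
      then have "w ^ m = w ^ k * w ^ (m - k)"
        by (simp flip: power_add)
      then show "f k * g (m - k) * w ^ m = f k * w ^ k * (g (m - k) * w ^ (m - k))"
        by simp
    qed simp
    have 1: "y / z * w ^ Suc m = w * ((y * w ^ m) / z)" for y z :: 'a by simp
    have 2: "x * y / z * w ^ Suc m = w * (x * (y * w ^ m) / z)" for x y z :: 'a by simp
    have s: "sn_coeff a b n * w ^ n = w * sn_coeff (w\<^sup>2 * a) (w\<^sup>2 * b) n"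
      unfolding Suc coeff_Suc 1 conv by (simp add: IH del: of_nat_Suc)
    have c: "cn_coeff a b n * w ^ n = cn_coeff (w\<^sup>2 * a) (w\<^sup>2 * b) n"
      unfolding Suc coeff_Suc 2 conv
      by (simp add: IH power2_eq_square mult.assoc del: of_nat_Suc flip: sum_distrib_left)
    have d: "dn_coeff a b n * w ^ n = dn_coeff (w\<^sup>2 * a) (w\<^sup>2 * b) n"
      unfolding Suc coeff_Suc 2 conv
      by (simp add: IH power2_eq_square mult.assoc del: of_nat_Suc flip: sum_distrib_left)
    from s c d show ?thesis by blast
  qed auto
qed

text \<open>The initial value problem has only one formal power series solution, because the
  equations determine each coefficient from the earlier ones. Any solution analytic at 0 is thereby
  identified.\<close>

lemma has_fps_expansion_coeff:
  fixes s c d :: "complex \<Rightarrow> complex"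
  assumes an: "s analytic_on {0}" "c analytic_on {0}" "d analytic_on {0}"
    and init: "s 0 = 0" "c 0 = 1" "d 0 = 1"
    and ode: "eventually (\<lambda>z. (s has_field_derivative c z * d z) (at z)) (nhds 0)"
      "eventually (\<lambda>z. (c has_field_derivative a * (s z * d z)) (at z)) (nhds 0)"
      "eventually (\<lambda>z. (d has_field_derivative b * (s z * c z)) (at z)) (nhds 0)"
  shows "s has_fps_expansion Abs_fps (sn_coeff a b)"
    "c has_fps_expansion Abs_fps (cn_coeff a b)"
    "d has_fps_expansion Abs_fps (dn_coeff a b)"
proof -
  obtain S C D where S: "s has_fps_expansion S" and C: "c has_fps_expansion C"
    and D: "d has_fps_expansion D"
    using an analytic_at_imp_has_fps_expansion_0 by blast
  \<comment> \<open>Uniqueness of expansions turns a differential equation near 0 into an identity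
    between formal series.\<close>
  have der: "fps_deriv F = G"
    if "f has_fps_expansion F" "g has_fps_expansion G"
      "eventually (\<lambda>z. (f has_field_derivative g z) (at z)) (nhds 0)" for f g :: "complex \<Rightarrow> complex" and F G
  proof -
    have "eventually (\<lambda>z. deriv f z = g z) (nhds 0)"
      using that(3) by eventually_elim (rule DERIV_imp_deriv)
    then have "deriv f has_fps_expansion G \<longleftrightarrow> g has_fps_expansion G"
      by (intro has_fps_expansion_cong) auto
    with that show ?thesis
      using fps_expansion_unique_complex has_fps_expansion_deriv by blast
  qed
  have ds: "fps_deriv S = C * D"
    by (rule der[OF S _ ode(1)]) (intro fps_expansion_intros C D)
  have dc: "fps_deriv C = fps_const a * (S * D)"
    by (rule der[OF C _ ode(2)]) (intro fps_expansion_intros S D)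
  have dd: "fps_deriv D = fps_const b * (S * C)"
    by (rule der[OF D _ ode(3)]) (intro fps_expansion_intros S C)
  have nth0: "fps_nth S 0 = 0" "fps_nth C 0 = 1" "fps_nth D 0 = 1"
    using init S C D has_fps_expansion_imp_0_eq_fps_nth_0 by metis+
  have "fps_nth S n = sn_coeff a b n \<and> fps_nth C n = cn_coeff a b n \<and> fps_nth D n = dn_coeff a b n" for n
  proof (induction n rule: less_induct)
    case (less n)
    show ?case
    proof (cases n)
      case (Suc m)
      have IH: "fps_nth S k = sn_coeff a b k" "fps_nth C k = cn_coeff a b k"
        "fps_nth D k = dn_coeff a b k" if "k \<le> m" for k
        using less.IH[of k] that Suc by auto
      have nz: "(of_nat (Suc m) :: complex) \<noteq> 0" by (simp del: of_nat_Suc)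
      have "of_nat (Suc m) * fps_nth F (Suc m) = fps_nth (fps_deriv F) m" for F :: "complex fps"
        by simp
      then have *: "fps_nth F (Suc m) = fps_nth (fps_deriv F) m / of_nat (Suc m)" for F :: "complex fps"
        using nz by (simp add: field_simps del: of_nat_Suc)
      have prod: "fps_nth (F * G) m = (\<Sum>k\<le>m. fps_nth F k * fps_nth G (m - k))" for F G :: "complex fps"
        by (simp add: fps_mult_nth atMost_atLeast0)
      show ?thesis
        unfolding Suc coeff_Suc * ds dc dd fps_mult_left_const_nth prod[of C D] prod[of S D] prod[of S C] by (simp add: IH)
    qed (simp add: nth0)
  qed
  then have "S = Abs_fps (sn_coeff a b)" "C = Abs_fps (cn_coeff a b)" "D = Abs_fps (dn_coeff a b)"
    by (auto simp: fps_eq_iff)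
  with S C D show "s has_fps_expansion Abs_fps (sn_coeff a b)"
    "c has_fps_expansion Abs_fps (cn_coeff a b)"
    "d has_fps_expansion Abs_fps (dn_coeff a b)" by auto
qed

lemma fps_deriv_coeff:
  fixes a b :: "'a::real_normed_field"
  shows "fps_deriv (Abs_fps (sn_coeff a b)) = Abs_fps (cn_coeff a b) * Abs_fps (dn_coeff a b)"
    "fps_deriv (Abs_fps (cn_coeff a b)) = fps_const a * (Abs_fps (sn_coeff a b) * Abs_fps (dn_coeff a b))"
    "fps_deriv (Abs_fps (dn_coeff a b)) = fps_const b * (Abs_fps (sn_coeff a b) * Abs_fps (cn_coeff a b))"
proof -
  have nz: "of_nat (Suc n) * (x / of_nat (Suc n)) = x" for n and x :: 'a
    by (simp del: of_nat_Suc)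
  have prod: "fps_nth (Abs_fps f * Abs_fps g) m = (\<Sum>k\<le>m. f k * g (m - k))" for m and f g :: "nat \<Rightarrow> 'a"
    by (simp add: fps_mult_nth atMost_atLeast0)
  show "fps_deriv (Abs_fps (sn_coeff a b)) = Abs_fps (cn_coeff a b) * Abs_fps (dn_coeff a b)"
    "fps_deriv (Abs_fps (cn_coeff a b)) = fps_const a * (Abs_fps (sn_coeff a b) * Abs_fps (dn_coeff a b))"
    "fps_deriv (Abs_fps (dn_coeff a b)) = fps_const b * (Abs_fps (sn_coeff a b) * Abs_fps (cn_coeff a b))"
    unfolding fps_eq_iff fps_deriv_nth fps_mult_left_const_nth prod fps_nth_Abs_fps Suc_eq_plus1[symmetric]
      coeff_Suc nz
    by auto
qed

subsection \<open>Solutions on the disc of radius \<open>\<pi>/2\<close>\<close>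

lemma cos_nonzero_ball:
  fixes z :: complex
  assumes "norm z < pi / 2"
  shows "cos z \<noteq> 0"
  using cos_eq_zero_imp_norm_ge[of z] assms by auto

text \<open>\<open>tan' = sec\<^sup>2\<close> and \<open>sec' = tan * sec\<close> form the system
  with both parameters 1.\<close>

lemma has_fps_expansion_tan_sec:
  shows "(tan :: complex \<Rightarrow> complex) has_fps_expansion Abs_fps (sn_coeff 1 1)"
    "(\<lambda>z::complex. 1 / cos z) has_fps_expansion Abs_fps (cn_coeff 1 1)"
    "(\<lambda>z::complex. 1 / cos z) has_fps_expansion Abs_fps (dn_coeff 1 1)"
proof -
  have "eventually (\<lambda>z. z \<in> ball 0 (pi / 2)) (nhds (0 :: complex))"
    by (intro eventually_nhds_in_open) auto
  then have ev: "eventually (\<lambda>z::complex. cos z \<noteq> 0) (nhds 0)"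
    by eventually_elim (rule cos_nonzero_ball, simp only: mem_ball_0)
  have 1: "(tan :: complex \<Rightarrow> complex) analytic_on {0}"
    unfolding tan_def by (intro analytic_intros) auto
  have 2: "(\<lambda>z::complex. 1 / cos z) analytic_on {0}"
    by (intro analytic_intros) auto
  have 3: "eventually (\<lambda>z::complex. (tan has_field_derivative 1 / cos z * (1 / cos z)) (at z)) (nhds 0)"
    using ev by eventually_elim (auto intro!: derivative_eq_intros simp: field_simps power2_eq_square)
  have 4: "eventually (\<lambda>z::complex. ((\<lambda>z. 1 / cos z) has_field_derivative 1 * (tan z * (1 / cos z))) (at z)) (nhds 0)"
    using ev by eventually_elim (auto intro!: derivative_eq_intros simp: field_simps tan_def power2_eq_square)
  note * = has_fps_expansion_coeff[OF 1 2 2 _ _ _ 3 4 4]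
  show "(tan :: complex \<Rightarrow> complex) has_fps_expansion Abs_fps (sn_coeff 1 1)"
    "(\<lambda>z::complex. 1 / cos z) has_fps_expansion Abs_fps (cn_coeff 1 1)"
    "(\<lambda>z::complex. 1 / cos z) has_fps_expansion Abs_fps (dn_coeff 1 1)"
    by (intro *; simp)+
qed

lemma holomorphic_tan_sec:
  "(tan :: complex \<Rightarrow> complex) holomorphic_on ball 0 (pi / 2)"
  "(\<lambda>z::complex. 1 / cos z) holomorphic_on ball 0 (pi / 2)"
  unfolding tan_def by (auto intro!: holomorphic_intros simp: cos_nonzero_ball)

text \<open>Comparison with the parameters \<open>(1, 1)\<close>, whose series converge in the disc
  because \<open>tan\<close> and \<open>1 / cos\<close> are holomorphic there.\<close>

lemma conv_radius_coeff:
  fixes a b :: "'a::{banach, real_normed_field}"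
  assumes "norm a \<le> 1" "norm b \<le> 1"
  shows "ereal (pi / 2) \<le> fps_conv_radius (Abs_fps (sn_coeff a b))"
    "ereal (pi / 2) \<le> fps_conv_radius (Abs_fps (cn_coeff a b))"
    "ereal (pi / 2) \<le> fps_conv_radius (Abs_fps (dn_coeff a b))"
proof -
  have *: "ereal (pi / 2) \<le> fps_conv_radius (Abs_fps f)"
    if "\<And>n. norm (f n) \<le> norm (g n)" "h has_fps_expansion Abs_fps g" "h holomorphic_on ball 0 (pi / 2)"
    for f :: "nat \<Rightarrow> 'a" and g :: "nat \<Rightarrow> complex" and h
    unfolding fps_conv_radius_def fps_nth_Abs_fps
  proof (rule conv_radius_geI_ex')
    fix r assume r: "0 < r" "ereal r < ereal (pi / 2)"
    have "ereal (pi / 2) \<le> fps_conv_radius (Abs_fps g)"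
      by (rule holomorphic_on_imp_fps_conv_radius_ge[OF that(2)]) (use that(3) in simp)
    moreover have "ereal (norm (of_real r :: complex)) < ereal (pi / 2)"
      using r by simp
    ultimately have "summable (\<lambda>n. norm (fps_nth (Abs_fps g) n * of_real r ^ n))"
      by (intro norm_summable_fps) (rule less_le_trans)
    then show "summable (\<lambda>n. f n * of_real r ^ n)"
      by (rule summable_comparison_test[rotated])
        (use r in \<open>auto simp: norm_mult norm_power intro!: mult_right_mono that(1)\<close>)
  qed
  \<comment> \<open>The majorants are real, whereas the radius bound is known for the complex series
    of \<open>tan\<close> and \<open>1 / cos\<close>; nonnegativity makes the norms of the complex
    coefficients equal to the real ones.\<close>
  have "sn_coeff (1::real) 1 n \<ge> 0 \<and> cn_coeff (1::real) 1 n \<ge> 0 \<and> dn_coeff (1::real) 1 n \<ge> 0" for n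
    using norm_coeff_le[of "1::real" 1 1 1 n] by auto
  then have "norm (sn_coeff a b n) \<le> norm (sn_coeff (1::complex) 1 n) \<and>
      norm (cn_coeff a b n) \<le> norm (cn_coeff (1::complex) 1 n) \<and>
      norm (dn_coeff a b n) \<le> norm (dn_coeff (1::complex) 1 n)" for n
    using norm_coeff_le[OF assms, of n] of_real_coeff[of 1 1 n, where 'a = complex] by simp
  then show "ereal (pi / 2) \<le> fps_conv_radius (Abs_fps (sn_coeff a b))"
    "ereal (pi / 2) \<le> fps_conv_radius (Abs_fps (cn_coeff a b))"
    "ereal (pi / 2) \<le> fps_conv_radius (Abs_fps (dn_coeff a b))"
    using *[OF _ has_fps_expansion_tan_sec(1) holomorphic_tan_sec(1)]
      *[OF _ has_fps_expansion_tan_sec(2) holomorphic_tan_sec(2)]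
      *[OF _ has_fps_expansion_tan_sec(3) holomorphic_tan_sec(2)] by blast+
qed

lemma conv_radius_coeff':
  fixes a b z :: "'a::{banach, real_normed_field}"
  assumes "norm a \<le> 1" "norm b \<le> 1" "norm z < pi / 2"
  shows "ereal (norm z) < fps_conv_radius (Abs_fps (sn_coeff a b))"
    "ereal (norm z) < fps_conv_radius (Abs_fps (cn_coeff a b))"
    "ereal (norm z) < fps_conv_radius (Abs_fps (dn_coeff a b))"
  using conv_radius_coeff[OF assms(1,2), THEN less_le_trans[rotated]] assms(3)
  by (simp_all only: ereal_less_le less_ereal.simps)

section \<open>The sums of the series as solutions of the system\<close>

lemma g_sums:
  fixes a b z :: "'a::{banach, real_normed_field}"
  assumes "norm a \<le> 1" "norm b \<le> 1" "norm z < pi / 2"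
  shows "(\<lambda>n. sn_coeff a b n * z ^ n) sums gsn a b z"
    "(\<lambda>n. cn_coeff a b n * z ^ n) sums gcn a b z"
    "(\<lambda>n. dn_coeff a b n * z ^ n) sums gdn a b z"
  using conv_radius_coeff'[OF assms, THEN sums_eval_fps] by (simp_all add: gsn_def gcn_def gdn_def)

lemma g_0 [simp]: "gsn a b 0 = 0" "gcn a b 0 = 1" "gdn a b 0 = 1"
  by (simp_all add: gsn_def gcn_def gdn_def eval_fps_at_0)

lemma g_deriv:
  fixes a b z :: "'a::{banach, real_normed_field}"
  assumes "norm a \<le> 1" "norm b \<le> 1" "norm z < pi / 2"
  shows "(gsn a b has_field_derivative gcn a b z * gdn a b z) (at z)"
    "(gcn a b has_field_derivative a * (gsn a b z * gdn a b z)) (at z)"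
    "(gdn a b has_field_derivative b * (gsn a b z * gcn a b z)) (at z)"
proof -
  note r = conv_radius_coeff'[OF assms]
  have mult: "eval_fps (fps_const c * (F * G)) z = c * (eval_fps F z * eval_fps G z)"
    if "ereal (norm z) < fps_conv_radius F" "ereal (norm z) < fps_conv_radius G" for c and F G :: "'a fps"
  proof -
    have "ereal (norm z) < fps_conv_radius (F * G)"
      using that fps_conv_radius_mult[of F G] by (meson less_le_trans min_less_iff_conj)
    then show ?thesis
      using that by (simp add: eval_fps_mult)
  qed
  show "(gsn a b has_field_derivative gcn a b z * gdn a b z) (at z)"
    using has_field_derivative_eval_fps[OF r(1), of UNIV]
    by (simp add: fps_deriv_coeff eval_fps_mult r gsn_def gcn_def gdn_def)
  show "(gcn a b has_field_derivative a * (gsn a b z * gdn a b z)) (at z)"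
    using has_field_derivative_eval_fps[OF r(2), of UNIV]
    by (simp add: fps_deriv_coeff mult r gsn_def gcn_def gdn_def)
  show "(gdn a b has_field_derivative b * (gsn a b z * gcn a b z)) (at z)"
    using has_field_derivative_eval_fps[OF r(3), of UNIV]
    by (simp add: fps_deriv_coeff mult r gsn_def gcn_def gdn_def)
qed

lemma holomorphic_on_ballI:
  assumes "\<And>z. norm z < r \<Longrightarrow> (f has_field_derivative f' z) (at z)"
  shows "f holomorphic_on ball 0 r"
  using assms by (subst holomorphic_on_open) (simp only: open_ball, metis mem_ball_0)

lemma g_holomorphic:
  fixes a b :: complex
  assumes "norm a \<le> 1" "norm b \<le> 1"
  shows "gsn a b holomorphic_on ball 0 (pi / 2)" "gcn a b holomorphic_on ball 0 (pi / 2)"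
    "gdn a b holomorphic_on ball 0 (pi / 2)"
  by (rule holomorphic_on_ballI, rule g_deriv[OF assms], assumption)+

text \<open>The expansions at 0 agree, and a function holomorphic on a disc is the sum of its series
  there. The radius \<open>r\<close> is left free because the imaginary transformation first knows
  its quotients only near 0.\<close>

lemma g_unique:
  fixes s c d :: "complex \<Rightarrow> complex"
  assumes "norm a \<le> 1" "norm b \<le> 1" "0 < r" "r \<le> pi / 2"
    and init: "s 0 = 0" "c 0 = 1" "d 0 = 1"
    and ode: "\<And>z. norm z < r \<Longrightarrow> (s has_field_derivative c z * d z) (at z)"
      "\<And>z. norm z < r \<Longrightarrow> (c has_field_derivative a * (s z * d z)) (at z)"
      "\<And>z. norm z < r \<Longrightarrow> (d has_field_derivative b * (s z * c z)) (at z)"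
    and z: "norm z < r"
  shows "s z = gsn a b z" "c z = gcn a b z" "d z = gdn a b z"
proof -
  have hol: "s holomorphic_on ball 0 r" "c holomorphic_on ball 0 r" "d holomorphic_on ball 0 r"
    by (rule holomorphic_on_ballI, rule ode, assumption)+
  then have an: "s analytic_on {0}" "c analytic_on {0}" "d analytic_on {0}"
    using \<open>0 < r\<close> by (auto simp: analytic_at intro: open_ball centre_in_ball[THEN iffD2])
  have ev: "eventually P (nhds 0)" if "\<And>z. norm z < r \<Longrightarrow> P z" for P :: "complex \<Rightarrow> bool"
    using eventually_nhds_in_open[of "ball 0 r" "0 :: complex"] \<open>0 < r\<close>
    by (auto elim!: eventually_mono simp: that)
  have "eventually (\<lambda>z. (s has_field_derivative c z * d z) (at z)) (nhds 0)"
    "eventually (\<lambda>z. (c has_field_derivative a * (s z * d z)) (at z)) (nhds 0)"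
    "eventually (\<lambda>z. (d has_field_derivative b * (s z * c z)) (at z)) (nhds 0)"
    by (rule ev, rule ode, assumption)+
  note F = has_fps_expansion_coeff[OF an init this]
  show "s z = gsn a b z" "c z = gcn a b z" "d z = gdn a b z"
    using F[THEN has_fps_expansion_imp_eval_fps_eq, OF z] hol
    by (auto simp: gsn_def gcn_def gdn_def)
qed

section \<open>First integrals\<close>

lemma DERIV_zero_ball:
  fixes f :: "complex \<Rightarrow> complex"
  assumes "\<And>x. norm x < r \<Longrightarrow> (f has_field_derivative 0) (at x)" "norm z < r"
  shows "f z = f 0"
proof -
  have "\<exists>k. \<forall>x\<in>ball 0 r. f x = k"
    by (rule has_field_derivative_zero_constant)
      (simp_all only: convex_ball mem_ball_0 has_field_derivative_at_within assms(1))
  moreover have "0 < r"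
    using assms(2) norm_ge_zero le_less_trans by blast
  ultimately show ?thesis
    using assms(2) by (metis norm_zero mem_ball_0)
qed

text \<open>Both \<open>c\<^sup>2 - a * s\<^sup>2\<close> and
  \<open>d\<^sup>2 - b * s\<^sup>2\<close> have derivative zero along a solution. For the Jacobian
  parameters these are the relations between the squares of sn, cn and dn.\<close>

lemma g_squares:
  fixes a b z :: complex
  assumes "norm a \<le> 1" "norm b \<le> 1" "norm z < pi / 2"
  shows "(gcn a b z)\<^sup>2 = 1 + a * (gsn a b z)\<^sup>2" "(gdn a b z)\<^sup>2 = 1 + b * (gsn a b z)\<^sup>2"
proof -
  have "(gcn a b z)\<^sup>2 - a * (gsn a b z)\<^sup>2 = (gcn a b 0)\<^sup>2 - a * (gsn a b 0)\<^sup>2"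
    by (rule DERIV_zero_ball[OF _ assms(3)]) (auto intro!: derivative_eq_intros g_deriv assms simp: algebra_simps)
  then show "(gcn a b z)\<^sup>2 = 1 + a * (gsn a b z)\<^sup>2" by (simp add: algebra_simps)
  have "(gdn a b z)\<^sup>2 - b * (gsn a b z)\<^sup>2 = (gdn a b 0)\<^sup>2 - b * (gsn a b 0)\<^sup>2"
    by (rule DERIV_zero_ball[OF _ assms(3)]) (auto intro!: derivative_eq_intros g_deriv assms simp: algebra_simps)
  then show "(gdn a b z)\<^sup>2 = 1 + b * (gsn a b z)\<^sup>2" by (simp add: algebra_simps)
qed

text \<open>Termwise comparison of the series. The bounds \<open>(1, norm m)\<close> yield the first
  inequality of each pair in the theorem, and \<open>(1, 1)\<close> the second.\<close>

lemma g_norm_le: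
  fixes a b z :: "'a::{banach, real_normed_field}"
  assumes "norm a \<le> A" "norm b \<le> B" "A \<le> 1" "B \<le> 1" "norm z < pi / 2"
  shows "norm (gsn a b z) \<le> gsn A B (norm z)" "norm (gcn a b z) \<le> gcn A B (norm z)"
    "norm (gdn a b z) \<le> gdn A B (norm z)"
proof -
  have AB: "0 \<le> A" "0 \<le> B" using assms(1,2) norm_ge_zero order_trans by blast+
  have s1: "(\<lambda>n. sn_coeff a b n * z ^ n) sums gsn a b z" "(\<lambda>n. cn_coeff a b n * z ^ n) sums gcn a b z"
    "(\<lambda>n. dn_coeff a b n * z ^ n) sums gdn a b z"
    by (rule g_sums; use assms in simp)+
  have s2: "(\<lambda>n. sn_coeff A B n * norm z ^ n) sums gsn A B (norm z)"
    "(\<lambda>n. cn_coeff A B n * norm z ^ n) sums gcn A B (norm z)"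
    "(\<lambda>n. dn_coeff A B n * norm z ^ n) sums gdn A B (norm z)"
    by (rule g_sums; use assms AB in simp)+
  have le: "norm y \<le> Y" if "(\<lambda>n. f n * z ^ n) sums y" "(\<lambda>n. F n * norm z ^ n) sums Y"
    "\<And>n. norm (f n) \<le> F n" for f F y Y
  proof -
    have n: "norm (f n * z ^ n) \<le> F n * norm z ^ n" for n
      by (simp add: norm_mult norm_power mult_right_mono that(3))
    have "norm (\<Sum>n. f n * z ^ n) \<le> (\<Sum>n. F n * norm z ^ n)"
      by (rule norm_suminf_le) (use n that(2) in \<open>auto simp: sums_iff\<close>)
    with that show ?thesis by (simp add: sums_iff)
  qed
  show "norm (gsn a b z) \<le> gsn A B (norm z)" "norm (gcn a b z) \<le> gcn A B (norm z)"
    "norm (gdn a b z) \<le> gdn A B (norm z)"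
    using le[OF s1(1) s2(1)] le[OF s1(2) s2(2)] le[OF s1(3) s2(3)] norm_coeff_le[OF assms(1,2)] by auto
qed

section \<open>Real arguments, rotation and the imaginary transformation\<close>

lemma g_of_real:
  assumes "\<bar>a\<bar> \<le> 1" "\<bar>b\<bar> \<le> 1" "\<bar>x\<bar> < pi / 2"
  shows "gsn (complex_of_real a) (of_real b) (of_real x) = of_real (gsn a b x)"
    "gcn (complex_of_real a) (of_real b) (of_real x) = of_real (gcn a b x)"
    "gdn (complex_of_real a) (of_real b) (of_real x) = of_real (gdn a b x)"
proof -
  have "(\<lambda>n. complex_of_real (f n * x ^ n)) sums complex_of_real y" if "(\<lambda>n. f n * x ^ n) sums y" for f y
    using that by (rule sums_of_real)
  note r = this[OF g_sums(1)] this[OF g_sums(2)] this[OF g_sums(3)]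
  show "gsn (complex_of_real a) (of_real b) (of_real x) = of_real (gsn a b x)"
    "gcn (complex_of_real a) (of_real b) (of_real x) = of_real (gcn a b x)"
    "gdn (complex_of_real a) (of_real b) (of_real x) = of_real (gdn a b x)"
    using g_sums[of "complex_of_real a" "of_real b" "of_real x"] r[of a b] assms
    by (auto simp: of_real_coeff intro: sums_unique2)
qed

lemma g_1_1:
  assumes "\<bar>x\<bar> < pi / 2"
  shows "gsn 1 1 x = tan x" "gcn 1 1 x = 1 / cos x" "gdn 1 1 x = 1 / cos x"
proof -
  have x: "norm (complex_of_real x) < pi / 2" using assms by simp
  have cos: "cos (complex_of_real x) \<noteq> 0" using x by (rule cos_nonzero_ball)
  note e = has_fps_expansion_imp_eval_fps_eq[OF _ x]
  have "complex_of_real (gsn 1 1 x) = tan (complex_of_real x)"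
    using e[OF has_fps_expansion_tan_sec(1) holomorphic_tan_sec(1)] g_of_real(1)[of 1 1 x] assms
    by (simp add: gsn_def)
  then show "gsn 1 1 x = tan x"
    unfolding tan_def sin_of_real cos_of_real by (simp flip: of_real_divide)
  have "complex_of_real (gcn 1 1 x) = complex_of_real (1 / cos x)"
    "complex_of_real (gdn 1 1 x) = complex_of_real (1 / cos x)"
    using e[OF has_fps_expansion_tan_sec(2) holomorphic_tan_sec(2)] 
      e[OF has_fps_expansion_tan_sec(3) holomorphic_tan_sec(2)] g_of_real(2,3)[of 1 1 x] assms
    by (simp_all add: gcn_def gdn_def cos_of_real)
  then show "gcn 1 1 x = 1 / cos x" "gdn 1 1 x = 1 / cos x"
    unfolding of_real_eq_iff .
qed

lemma g_scale:
  fixes w :: "'a::{banach, real_normed_field}"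
  assumes "norm w = 1" "norm a \<le> 1" "norm b \<le> 1" "norm z < pi / 2"
  shows "gsn a b (w * z) = w * gsn (w\<^sup>2 * a) (w\<^sup>2 * b) z" "gcn a b (w * z) = gcn (w\<^sup>2 * a) (w\<^sup>2 * b) z"
    "gdn a b (w * z) = gdn (w\<^sup>2 * a) (w\<^sup>2 * b) z"
proof -
  have n: "norm (w\<^sup>2 * a) \<le> 1" "norm (w\<^sup>2 * b) \<le> 1" "norm (w * z) < pi / 2"
    using assms by (simp_all add: norm_mult norm_power)
  have e: "f * (w * z) ^ n = f * w ^ n * z ^ n" for f n by (simp add: power_mult_distrib)
  note l = g_sums[OF assms(2,3) n(3), unfolded e]
  note r = g_sums[OF n(1,2) assms(4)]
  show "gsn a b (w * z) = w * gsn (w\<^sup>2 * a) (w\<^sup>2 * b) z" "gcn a b (w * z) = gcn (w\<^sup>2 * a) (w\<^sup>2 * b) z"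
    "gdn a b (w * z) = gdn (w\<^sup>2 * a) (w\<^sup>2 * b) z"
    using sums_unique2[OF l(1)] sums_unique2[OF l(2)] sums_unique2[OF l(3)] sums_mult[OF r(1), of w] r
    by (simp_all add: coeff_scale mult.assoc)
qed

text \<open>By the first integrals, \<open>S / C\<close>, \<open>1 / C\<close> and
  \<open>D / C\<close> solve the system for \<open>(-1, \<mu> - 1)\<close>. The identities are
  stated as products because zeros of \<open>gcn 1 \<mu>\<close> are not excluded beforehand; the
  second identity then excludes them.\<close>

lemma g_imaginary_transformation:
  fixes \<mu> z :: complex
  assumes "norm \<mu> \<le> 1" "norm (1 - \<mu>) \<le> 1" "norm z < pi / 2"
  shows "gsn (-1) (\<mu> - 1) z * gcn 1 \<mu> z = gsn 1 \<mu> z" "gcn (-1) (\<mu> - 1) z * gcn 1 \<mu> z = 1"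
    "gdn (-1) (\<mu> - 1) z * gcn 1 \<mu> z = gdn 1 \<mu> z"
proof -
  have m1: "norm (-1 :: complex) \<le> 1" "norm (\<mu> - 1) \<le> 1"
    using assms(2) by (simp_all add: norm_minus_commute)
  define S C D where "S = gsn 1 \<mu>" and "C = gcn 1 \<mu>" and "D = gdn 1 \<mu>"
  have hol: "S holomorphic_on ball 0 (pi/2)" "C holomorphic_on ball 0 (pi/2)" "D holomorphic_on ball 0 (pi/2)"
    unfolding S_def C_def D_def by (rule g_holomorphic; use assms in simp)+
  have der: "(S has_field_derivative C z * D z) (at z)" "(C has_field_derivative S z * D z) (at z)"
    "(D has_field_derivative \<mu> * (S z * C z)) (at z)" if "norm z < pi / 2" for z
    using g_deriv[of 1 \<mu> z] assms that by (simp_all add: S_def C_def D_def)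
  have init: "S 0 = 0" "C 0 = 1" "D 0 = 1" by (simp_all add: S_def C_def D_def)
  have "isCont C 0" using der(2)[of 0] DERIV_isCont by fastforce
  then obtain e where e: "e > 0" "\<And>x. norm x < e \<Longrightarrow> C x \<noteq> 0"
    using continuous_at_avoid[of 0 C 0] init by (auto simp: dist_norm)
  \<comment> \<open>On this possibly smaller disc \<open>C\<close> has no zeros, so the quotients
    may be formed.\<close>
  define r where "r = min e (pi / 2)"
  have r: "0 < r" "r \<le> pi / 2" using e by (auto simp: r_def)
  have nz: "C x \<noteq> 0" if "norm x < r" for x using that e by (auto simp: r_def)
  have sq: "(C x)\<^sup>2 = 1 + (S x)\<^sup>2" "(D x)\<^sup>2 = 1 + \<mu> * (S x)\<^sup>2" if "norm x < r" for x
    using g_squares[of 1 \<mu> x] that assms r by (simp_all add: S_def C_def D_def)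
  have 1: "((\<lambda>z. S z / C z) has_field_derivative 1 / C x * (D x / C x)) (at x)" if x: "norm x < r" for x
  proof -
    have "((\<lambda>z. S z / C z) has_field_derivative (C x * D x * C x - S x * (S x * D x)) / (C x * C x)) (at x)"
      using x r nz by (intro DERIV_divide der) auto
    also have "C x * D x * C x - S x * (S x * D x) = D x * ((C x)\<^sup>2 - (S x)\<^sup>2)"
      by (simp add: algebra_simps power2_eq_square)
    finally show ?thesis using sq[OF x] by simp
  qed
  have 2: "((\<lambda>z. 1 / C z) has_field_derivative -1 * (S x / C x * (D x / C x))) (at x)" if x: "norm x < r" for x
    using x r nz[OF x] by (auto intro!: derivative_eq_intros der)
  have 3: "((\<lambda>z. D z / C z) has_field_derivative (\<mu> - 1) * (S x / C x * (1 / C x))) (at x)" if x: "norm x < r" for x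
  proof -
    have "((\<lambda>z. D z / C z) has_field_derivative (\<mu> * (S x * C x) * C x - D x * (S x * D x)) / (C x * C x)) (at x)"
      using x r nz by (intro DERIV_divide der) auto
    also have "\<mu> * (S x * C x) * C x - D x * (S x * D x) = S x * (\<mu> * (C x)\<^sup>2 - (D x)\<^sup>2)"
      by (simp add: algebra_simps power2_eq_square)
    finally show ?thesis using sq[OF x] by (simp add: algebra_simps)
  qed
  have init': "S 0 / C 0 = 0" "1 / C 0 = 1" "D 0 / C 0 = 1" using init by simp_all
  note eq = g_unique[OF m1 r init' 1 2 3]
  have hol': "gsn (-1) (\<mu> - 1) holomorphic_on ball 0 (pi/2)" "gcn (-1) (\<mu> - 1) holomorphic_on ball 0 (pi/2)"
    "gdn (-1) (\<mu> - 1) holomorphic_on ball 0 (pi/2)"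
    by (rule g_holomorphic[OF m1])+
  \<comment> \<open>The multiplied-out identities make sense on the whole disc and spread there by
    the identity theorem.\<close>
  have cont: "f z = g z" if "\<And>z. z \<in> ball 0 r \<Longrightarrow> f z = g z" "f holomorphic_on ball 0 (pi/2)"
    "g holomorphic_on ball 0 (pi/2)" for f g
    by (rule analytic_continuation_open[of "ball 0 r" "ball 0 (pi/2)" f g])
      (use r assms(3) that in auto)
  have "gsn (-1) (\<mu> - 1) z * C z = S z"
    by (rule cont[of "\<lambda>z. gsn (-1) (\<mu> - 1) z * C z"])
      (auto intro!: holomorphic_intros hol hol' simp: nz eq(1)[symmetric])
  moreover have "gcn (-1) (\<mu> - 1) z * C z = 1"
    by (rule cont[of "\<lambda>z. gcn (-1) (\<mu> - 1) z * C z" "\<lambda>_. 1"])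
      (auto intro!: holomorphic_intros hol hol' simp: nz eq(2)[symmetric])
  moreover have "gdn (-1) (\<mu> - 1) z * C z = D z"
    by (rule cont[of "\<lambda>z. gdn (-1) (\<mu> - 1) z * C z"])
      (auto intro!: holomorphic_intros hol hol' simp: nz eq(3)[symmetric])
  ultimately show "gsn (-1) (\<mu> - 1) z * gcn 1 \<mu> z = gsn 1 \<mu> z" "gcn (-1) (\<mu> - 1) z * gcn 1 \<mu> z = 1"
    "gdn (-1) (\<mu> - 1) z * gcn 1 \<mu> z = gdn 1 \<mu> z"
    by (simp_all add: S_def C_def D_def)
qed

subsection \<open>Duplication and analytic continuation\<close>

lemma norm_half_less:
  fixes z :: complex
  assumes "norm z < r"
  shows "norm (z / 2) < r"
proof -
  have "norm (z / 2) = norm z / 2" by (simp add: norm_divide)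
  with assms norm_ge_zero[of z] show ?thesis by linarith
qed

text \<open>The majorant \<open>tan\<close> is below 1 at arguments below \<open>pi / 4\<close>.
  This keeps the denominator of the duplication formulas away from 0.\<close>

lemma norm_gsn_half_less_1:
  fixes m z :: complex
  assumes "norm m \<le> 1" "norm z < pi / 2"
  shows "norm (gsn (-1) (-m) (z / 2)) < 1"
proof -
  have z: "norm (z / 2) < pi / 2" "norm (z / 2) < pi / 4"
    using norm_half_less[OF assms(2)] assms(2) by (simp_all add: norm_divide)
  have "norm (gsn (-1) (-m) (z / 2)) \<le> gsn 1 1 (norm (z / 2))"
    by (rule g_norm_le) (use assms z in auto)
  also have "\<dots> = tan (norm (z / 2))"
    by (rule g_1_1) (use z in auto)
  also have "\<dots> < tan (pi / 4)"
    by (rule tan_monotone) (use z(2) norm_ge_zero[of "z / 2"] pi_gt_zero in linarith)+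
  finally show ?thesis by (simp add: tan_45)
qed

lemma one_minus_quartic_nonzero:
  fixes m z :: complex
  assumes "norm m \<le> 1" "norm z < pi / 2"
  shows "1 - m * gsn (-1) (-m) (z / 2) ^ 4 \<noteq> 0"
proof -
  have "norm (m * gsn (-1) (-m) (z / 2) ^ 4) \<le> 1 * norm (gsn (-1) (-m) (z / 2)) ^ 4"
    unfolding norm_mult norm_power by (intro mult_right_mono assms) auto
  also have "\<dots> < 1"
    using norm_gsn_half_less_1[OF assms] by (simp add: power_less_one_iff)
  finally show ?thesis by auto
qed

text \<open>The right-hand sides, as functions of \<open>z\<close>, solve the initial value problem
  that characterises the left-hand sides.\<close>

lemma g_duplication:
  fixes m z :: complex
  assumes "norm m \<le> 1" "norm z < pi / 2"
  defines "s \<equiv> \<lambda>z. gsn (-1) (-m) (z / 2)" and "c \<equiv> \<lambda>z. gcn (-1) (-m) (z / 2)"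
    and "d \<equiv> \<lambda>z. gdn (-1) (-m) (z / 2)"
  defines "Q \<equiv> \<lambda>z. 1 - m * s z ^ 4"
  shows "gsn (-1) (-m) z = 2 * s z * c z * d z / Q z"
    "gcn (-1) (-m) z = ((c z)\<^sup>2 - (s z)\<^sup>2 * (d z)\<^sup>2) / Q z"
    "gdn (-1) (-m) z = ((d z)\<^sup>2 - m * (s z)\<^sup>2 * (c z)\<^sup>2) / Q z"
proof -
  have m: "norm (-1 :: complex) \<le> 1" "norm (- m) \<le> 1" using assms by simp_all
  have der: "(s has_field_derivative c x * d x / 2) (at x)"
    "(c has_field_derivative - (s x * d x) / 2) (at x)"
    "(d has_field_derivative - (m * (s x * c x)) / 2) (at x)" if "norm x < pi / 2" for x
  proof -
    have "norm (x / 2) < pi / 2" using that by (rule norm_half_less)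
    note g = g_deriv[OF m this]
    have h: "((\<lambda>x. x / 2) has_field_derivative 1 / 2) (at x)"
      by (auto intro!: derivative_eq_intros)
    show "(s has_field_derivative c x * d x / 2) (at x)"
      "(c has_field_derivative - (s x * d x) / 2) (at x)"
      "(d has_field_derivative - (m * (s x * c x)) / 2) (at x)"
      using DERIV_chain2[OF g(1) h] DERIV_chain2[OF g(2) h] DERIV_chain2[OF g(3) h]
      by (simp_all add: s_def c_def d_def)
  qed
  have sq: "(c x)\<^sup>2 = 1 - (s x)\<^sup>2" "(d x)\<^sup>2 = 1 - m * (s x)\<^sup>2" if "norm x < pi / 2" for x
    using g_squares[OF m norm_half_less[OF that]] by (simp_all add: s_def c_def d_def)
  have Q: "Q x \<noteq> 0" if "norm x < pi / 2" for x
    using one_minus_quartic_nonzero[OF assms(1) that] by (simp add: Q_def s_def)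
  have dQ: "(Q has_field_derivative - 2 * m * s x ^ 3 * c x * d x) (at x)" if "norm x < pi / 2" for x
    unfolding Q_def by (auto intro!: derivative_eq_intros der[OF that] simp: field_simps power3_eq_cube)
  \<comment> \<open>The quotient rule reduces each differential equation to the polynomial identity
    in the last premise, which follows from the relations \<open>sq\<close>.\<close>
  have quot: "((\<lambda>z. f z / Q z) has_field_derivative g x / Q x * (h x / Q x)) (at x)"
    if "norm x < pi / 2" "(f has_field_derivative f') (at x)"
      "f' * Q x + f x * (2 * m * s x ^ 3 * c x * d x) = g x * h x" for f f' g h x
  proof -
    have "((\<lambda>z. f z / Q z) has_field_derivative
        (f' * Q x - f x * (- 2 * m * s x ^ 3 * c x * d x)) / (Q x * Q x)) (at x)"
      by (rule DERIV_divide[OF that(2) dQ[OF that(1)] Q[OF that(1)]])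
    then show ?thesis using that(3) by simp
  qed
  define s2 c2 d2 where "s2 = (\<lambda>z. 2 * s z * c z * d z)" and "c2 = (\<lambda>z. (c z)\<^sup>2 - (s z)\<^sup>2 * (d z)\<^sup>2)"
    and "d2 = (\<lambda>z. (d z)\<^sup>2 - m * (s z)\<^sup>2 * (c z)\<^sup>2)"
  have 1: "((\<lambda>z. s2 z / Q z) has_field_derivative c2 x / Q x * (d2 x / Q x)) (at x)"
    if x: "norm x < pi / 2" for x
  proof (rule quot[OF x])
    show "(s2 has_field_derivative (c x)\<^sup>2 * (d x)\<^sup>2 - (s x)\<^sup>2 * (d x)\<^sup>2 - m * (s x)\<^sup>2 * (c x)\<^sup>2) (at x)"
      unfolding s2_def
      by (auto intro!: derivative_eq_intros der[OF x] simp: field_simps power2_eq_square)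
    show "((c x)\<^sup>2 * (d x)\<^sup>2 - (s x)\<^sup>2 * (d x)\<^sup>2 - m * (s x)\<^sup>2 * (c x)\<^sup>2) * Q x +
        s2 x * (2 * m * s x ^ 3 * c x * d x) = c2 x * d2 x"
      using sq[OF x] unfolding s2_def c2_def d2_def Q_def by algebra
  qed
  have 2: "((\<lambda>z. c2 z / Q z) has_field_derivative (-1) * (s2 x / Q x * (d2 x / Q x))) (at x)"
    if x: "norm x < pi / 2" for x
  proof -
    have "((\<lambda>z. c2 z / Q z) has_field_derivative (- s2 x) / Q x * (d2 x / Q x)) (at x)"
    proof (rule quot[OF x])
      show "(c2 has_field_derivative - s x * c x * d x * (1 + (d x)\<^sup>2 - m * (s x)\<^sup>2)) (at x)"
        unfolding c2_def
        by (auto intro!: derivative_eq_intros der[OF x] simp: field_simps power2_eq_square)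
      show "- s x * c x * d x * (1 + (d x)\<^sup>2 - m * (s x)\<^sup>2) * Q x + c2 x * (2 * m * s x ^ 3 * c x * d x) =
          - s2 x * d2 x"
        using sq[OF x] unfolding s2_def c2_def d2_def Q_def by algebra
    qed
    then show ?thesis by simp
  qed
  have 3: "((\<lambda>z. d2 z / Q z) has_field_derivative (- m) * (s2 x / Q x * (c2 x / Q x))) (at x)"
    if x: "norm x < pi / 2" for x
  proof -
    have "((\<lambda>z. d2 z / Q z) has_field_derivative (- m * s2 x) / Q x * (c2 x / Q x)) (at x)"
    proof (rule quot[OF x])
      show "(d2 has_field_derivative - m * s x * c x * d x * (1 + (c x)\<^sup>2 - (s x)\<^sup>2)) (at x)"
        unfolding d2_def
        by (auto intro!: derivative_eq_intros der[OF x] simp: field_simps power2_eq_square)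
      show "- m * s x * c x * d x * (1 + (c x)\<^sup>2 - (s x)\<^sup>2) * Q x + d2 x * (2 * m * s x ^ 3 * c x * d x) =
          - m * s2 x * c2 x"
        using sq[OF x] unfolding s2_def c2_def d2_def Q_def by algebra
    qed
    then show ?thesis by (simp add: mult.assoc)
  qed
  have init: "s2 0 / Q 0 = 0" "c2 0 / Q 0 = 1" "d2 0 / Q 0 = 1"
    by (simp_all add: s2_def c2_def d2_def Q_def s_def c_def d_def)
  show "gsn (-1) (-m) z = 2 * s z * c z * d z / Q z"
    "gcn (-1) (-m) z = ((c z)\<^sup>2 - (s z)\<^sup>2 * (d z)\<^sup>2) / Q z"
    "gdn (-1) (-m) z = ((d z)\<^sup>2 - m * (s z)\<^sup>2 * (c z)\<^sup>2) / Q z"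
    using g_unique[OF m pi_half_gt_zero order_refl init 1 2 3 assms(2)]
    by (simp_all add: s2_def c2_def d2_def)
qed

text \<open>
  \<open>\<Theta>\<close> is the theta function with \<open>(ln \<Theta>)'' = - m sn\<^sup>2\<close>. It clears the denominators in the duplication
  formulas, so that the poles of \<open>sn\<close>, \<open>cn\<close>, \<open>dn\<close> never have to be followed during the continuation.
\<close>

lemma theta_exists:
  fixes m :: complex
  assumes "norm m \<le> 1"
  obtains \<Theta> :: "complex \<Rightarrow> complex" where
    "\<Theta> holomorphic_on ball 0 (pi / 2)" "\<Theta> 0 = 1" "\<And>z. \<Theta> z \<noteq> 0"
    "\<And>z. norm z < pi / 2 \<Longrightarrow> \<Theta> z = \<Theta> (z / 2) ^ 4 * (1 - m * gsn (-1) (-m) (z / 2) ^ 4)"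
proof -
  have m: "norm (-1 :: complex) \<le> 1" "norm (- m) \<le> 1" using assms by simp_all
  define s c d where "s = gsn (-1) (-m)" and "c = gcn (-1) (-m)" and "d = gdn (-1) (-m)"
  have prim: "\<exists>g. g 0 = 0 \<and> (\<forall>x. norm x < pi / 2 \<longrightarrow> (g has_field_derivative f x) (at x))"
    if f: "f holomorphic_on ball 0 (pi / 2)" for f :: "complex \<Rightarrow> complex"
  proof -
    obtain g where g: "\<And>x. x \<in> ball 0 (pi / 2) \<Longrightarrow> (g has_field_derivative f x) (at x within ball 0 (pi / 2))"
      using holomorphic_convex_primitive'[OF convex_ball open_ball f] by blast
    then have "(g has_field_derivative f x) (at x)" if "norm x < pi / 2" for x
      using that by (metis at_within_open mem_ball_0 open_ball)
    then have "((\<lambda>x. g x - g 0) has_field_derivative f x) (at x)" if "norm x < pi / 2" for x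
      using that by (auto intro!: derivative_eq_intros)
    then show ?thesis by (intro exI[of _ "\<lambda>x. g x - g 0"]) auto
  qed
  \<comment> \<open>Two successive primitives, both 0 at the origin: \<open>E\<close> becomes the
    logarithmic derivative of the theta function and \<open>Z\<close> its logarithm. As an
    exponential, theta then has no zeros.\<close>
  have "(\<lambda>z. - m * (s z)\<^sup>2) holomorphic_on ball 0 (pi / 2)"
    unfolding s_def by (intro holomorphic_intros g_holomorphic m)
  then obtain E where E: "E 0 = 0" "\<And>x. norm x < pi / 2 \<Longrightarrow> (E has_field_derivative - m * (s x)\<^sup>2) (at x)"
    using prim by blast
  have "E holomorphic_on ball 0 (pi / 2)"
    by (rule holomorphic_on_ballI, rule E, assumption)
  then obtain Z where Z: "Z 0 = 0" "\<And>x. norm x < pi / 2 \<Longrightarrow> (Z has_field_derivative E x) (at x)"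
    using prim by blast
  have half: "((\<lambda>x. f (x / 2)) has_field_derivative f' (x / 2) / 2) (at x)"
    if "norm x < pi / 2" "\<And>x. norm x < pi / 2 \<Longrightarrow> (f has_field_derivative f' x) (at x)"
    for x :: complex and f f'
  proof -
    have "norm (x / 2) < pi / 2" using that(1) by (rule norm_half_less)
    moreover have "((\<lambda>x. x / 2) has_field_derivative 1 / 2) (at x)"
      by (auto intro!: derivative_eq_intros)
    ultimately show ?thesis
      using DERIV_chain2[OF that(2)] by fastforce
  qed
  have ds: "((\<lambda>x. s (x / 2)) has_field_derivative c (x / 2) * d (x / 2) / 2) (at x)" 
    and dc: "((\<lambda>x. c (x / 2)) has_field_derivative -1 * (s (x / 2) * d (x / 2)) / 2) (at x)" 
    and dd: "((\<lambda>x. d (x / 2)) has_field_derivative -m * (s (x / 2) * c (x / 2)) / 2) (at x)"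
    and dE: "((\<lambda>x. E (x / 2)) has_field_derivative - m * (s (x / 2))\<^sup>2 / 2) (at x)"
    and dZ: "((\<lambda>x. Z (x / 2)) has_field_derivative E (x / 2) / 2) (at x)"
    if "norm x < pi / 2" for x
    unfolding s_def c_def d_def
    using half[OF that, OF g_deriv(1)[OF m]] half[OF that, OF g_deriv(2)[OF m]] half[OF that, OF g_deriv(3)[OF m]]
      half[OF that, OF E(2)] half[OF that, OF Z(2)]
    by (simp_all add: s_def)
  have sq: "(c (x / 2))\<^sup>2 = 1 - (s (x / 2))\<^sup>2" "(d (x / 2))\<^sup>2 = 1 - m * (s (x / 2))\<^sup>2"
    if "norm x < pi / 2" for x
    using g_squares[OF m norm_half_less[OF that]] by (simp_all add: s_def c_def d_def)
  define Q where "Q = (\<lambda>z. 1 - m * s (z / 2) ^ 4)"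
  have Q: "Q x \<noteq> 0" if "norm x < pi / 2" for x
    using one_minus_quartic_nonzero[OF assms that] by (simp add: Q_def s_def)
  have dQ: "(Q has_field_derivative - 2 * m * s (x / 2) ^ 3 * c (x / 2) * d (x / 2)) (at x)"
    if "norm x < pi / 2" for x
    unfolding Q_def by (auto intro!: derivative_eq_intros ds[OF that] simp: field_simps power3_eq_cube)
  define w where "w = (\<lambda>z. s (z / 2) ^ 3 * c (z / 2) * d (z / 2))"
  \<comment> \<open>This is the derivative of \<open>Z z = 4 * Z (z / 2) + ln (Q z)\<close>, since
    \<open>Q' = - 2 * m * w\<close>. One more differentiation eliminates \<open>E\<close> and leaves
    an identity in \<open>s\<close>, \<open>c\<close>, \<open>d\<close>.\<close>
  have E_dup: "E z = 2 * E (z / 2) - 2 * m * w z / Q z" if z: "norm z < pi / 2" for z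
  proof -
    have "(\<lambda>z. 2 * E (z / 2) - 2 * m * w z / Q z - E z) z = (\<lambda>z. 2 * E (z / 2) - 2 * m * w z / Q z - E z) 0"
    proof (rule DERIV_zero_ball[OF _ z])
      fix x :: complex assume x: "norm x < pi / 2"
      define S C D where "S = s (x / 2)" and "C = c (x / 2)" and "D = d (x / 2)"
      have "(w has_field_derivative (3 * S\<^sup>2 * C\<^sup>2 * D\<^sup>2 - S ^ 4 * D\<^sup>2 - m * S ^ 4 * C\<^sup>2) / 2) (at x)"
        unfolding w_def S_def C_def D_def
        by (auto intro!: derivative_eq_intros ds[OF x] dc[OF x] dd[OF x]
            simp: field_simps power2_eq_square power3_eq_cube power4_eq_xxxx)
      then have "((\<lambda>z. w z / Q z) has_field_derivative
          ((3 * S\<^sup>2 * C\<^sup>2 * D\<^sup>2 - S ^ 4 * D\<^sup>2 - m * S ^ 4 * C\<^sup>2) / 2 * Q x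
            - w x * (- 2 * m * S ^ 3 * C * D)) / (Q x * Q x)) (at x)" (is "(_ has_field_derivative ?w') _")
        unfolding S_def C_def D_def by (rule DERIV_divide[OF _ dQ[OF x] Q[OF x]])
      then have "((\<lambda>z. 2 * E (z / 2) - 2 * m * (w z / Q z) - E z) has_field_derivative
          (2 * (- m * S\<^sup>2 / 2) - 2 * m * ?w' - (- m * (s x)\<^sup>2))) (at x)"
        unfolding S_def by (intro DERIV_diff DERIV_cmult dE[OF x] E(2)[OF x])
      moreover have "2 * (- m * S\<^sup>2 / 2) - 2 * m * ?w' - (- m * (s x)\<^sup>2) = 0"
      proof -
        \<comment> \<open>With the duplication formula, multiplication by
          \<open>(Q x)\<^sup>2\<close> makes the claim polynomial in \<open>S\<close>,
          \<open>C\<close>, \<open>D\<close>.\<close>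
        have sx: "s x = 2 * S * C * D / Q x"
          using g_duplication(1)[OF assms x] by (simp add: S_def C_def D_def s_def c_def d_def Q_def)
        have "(Q x)\<^sup>2 * S\<^sup>2 + ((3 * S\<^sup>2 * C\<^sup>2 * D\<^sup>2 - S ^ 4 * D\<^sup>2 - m * S ^ 4 * C\<^sup>2) * Q x
            + 2 * w x * (2 * m * S ^ 3 * C * D)) = (2 * S * C * D)\<^sup>2"
          using sq[OF x] unfolding w_def Q_def S_def[symmetric] C_def[symmetric] D_def[symmetric] by algebra
        moreover have "2 * (- m * S\<^sup>2 / 2) - 2 * m * ?w' - (- m * (s x)\<^sup>2) =
          - m * ((Q x)\<^sup>2 * S\<^sup>2 + ((3 * S\<^sup>2 * C\<^sup>2 * D\<^sup>2 - S ^ 4 * D\<^sup>2 - m * S ^ 4 * C\<^sup>2) * Q x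
            + 2 * w x * (2 * m * S ^ 3 * C * D)) - (2 * S * C * D)\<^sup>2) / (Q x)\<^sup>2"
          unfolding sx using Q[OF x] by (simp add: field_simps power2_eq_square)
        ultimately show ?thesis by simp
      qed
      ultimately show "((\<lambda>z. 2 * E (z / 2) - 2 * m * w z / Q z - E z) has_field_derivative 0) (at x)"
        by simp
    qed
    then show ?thesis by (simp add: E w_def s_def)
  qed
  have "exp (Z z) = exp (Z (z / 2)) ^ 4 * (1 - m * s (z / 2) ^ 4)" if z: "norm z < pi / 2" for z
  proof -
    \<comment> \<open>The quotient of the two sides is shown to be constant, which avoids choosing a
      branch of \<open>ln (Q z)\<close>.\<close>
    have "(\<lambda>z. exp (4 * Z (z / 2)) * Q z * exp (- Z z)) z = (\<lambda>z. exp (4 * Z (z / 2)) * Q z * exp (- Z z)) 0"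
    proof (rule DERIV_zero_ball[OF _ z])
      fix x :: complex assume x: "norm x < pi / 2"
      have "((\<lambda>z. exp (4 * Z (z / 2)) * Q z * exp (- Z z)) has_field_derivative
        exp (4 * Z (x / 2)) * exp (- Z x) * ((2 * E (x / 2) - E x) * Q x - 2 * m * w x)) (at x)"
        by (auto intro!: derivative_eq_intros dZ[OF x] Z(2)[OF x] dQ[OF x] simp: w_def algebra_simps)
      moreover have "(2 * E (x / 2) - E x) * Q x - 2 * m * w x = 0"
        using E_dup[OF x] Q[OF x] by (simp add: field_simps)
      ultimately show "((\<lambda>z. exp (4 * Z (z / 2)) * Q z * exp (- Z z)) has_field_derivative 0) (at x)"
        by simp
    qed
    then have "exp (4 * Z (z / 2)) * Q z = exp (Z z)"
      by (simp add: Z Q_def s_def exp_minus field_simps)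
    moreover have "exp (4 * Z (z / 2)) = exp (Z (z / 2)) ^ 4"
      by (simp flip: exp_of_nat_mult)
    ultimately show ?thesis by (simp add: Q_def)
  qed
  moreover have "(\<lambda>z. exp (Z z)) holomorphic_on ball 0 (pi / 2)"
    by (intro holomorphic_intros, rule holomorphic_on_ballI, rule Z, assumption)
  ultimately show ?thesis
    by (intro that[of "\<lambda>z. exp (Z z)"]) (simp_all add: Z s_def)
qed

text \<open>The right-hand side of the functional equation needs values only at
  \<open>z / 2\<close>, so it makes sense on a disc of twice the radius. Iteration reaches the whole
  plane, as \<open>P\<close> preserves holomorphy.\<close>

lemma entire_extension:
  fixes F :: "'i \<Rightarrow> complex \<Rightarrow> complex" and P :: "'i \<Rightarrow> ('i \<Rightarrow> complex) \<Rightarrow> complex"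
  assumes "0 < r" and F: "\<And>i. F i holomorphic_on ball 0 r"
    and P: "\<And>G A i. (\<And>j. G j holomorphic_on A) \<Longrightarrow> (\<lambda>z. P i (\<lambda>j. G j z)) holomorphic_on A"
    and dup: "\<And>i z. norm z < r \<Longrightarrow> F i z = P i (\<lambda>j. F j (z / 2))"
  obtains G where "\<And>i. G i holomorphic_on UNIV" "\<And>i z. norm z < r \<Longrightarrow> G i z = F i z"
proof -
  \<comment> \<open>\<open>H n\<close> is \<open>F\<close> after \<open>n\<close> uses of the
    functional equation, holomorphic on the disc of radius \<open>2 ^ n * r\<close>. Later stages
    agree with earlier ones on the smaller discs, so the stages can be glued.\<close>
  define H where "H = rec_nat F (\<lambda>_ K i z. P i (\<lambda>j. K j (z / 2)))"
  have H_0: "H 0 = F" and H_Suc: "H (Suc n) i z = P i (\<lambda>j. H n j (z / 2))" for n i z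
    by (simp_all add: H_def)
  have hol: "H n i holomorphic_on ball 0 (2 ^ n * r)" for n i
  proof (induction n arbitrary: i)
    case (Suc n)
    have "(\<lambda>z. z / 2) holomorphic_on ball 0 (2 ^ Suc n * r)"
      by (intro holomorphic_intros) simp
    moreover have "(\<lambda>z. z / 2) ` ball 0 (2 ^ Suc n * r) \<subseteq> ball (0 :: complex) (2 ^ n * r)"
      by (auto simp: norm_divide)
    ultimately have "(\<lambda>z. H n j (z / 2)) holomorphic_on ball 0 (2 ^ Suc n * r)" for j
      using holomorphic_on_compose_gen[OF _ Suc.IH] by (simp add: o_def)
    then have "(\<lambda>z. P i (\<lambda>j. H n j (z / 2))) holomorphic_on ball 0 (2 ^ Suc n * r)"
      by (rule P)
    then show ?case by (simp add: H_Suc[abs_def])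
  qed (simp add: H_0 F)
  have step: "H (Suc n) i z = H n i z" if "norm z < 2 ^ n * r" for n i z
    using that
  proof (induction n arbitrary: i z)
    case (Suc n)
    then have "norm (z / 2) < 2 ^ n * r" by (simp add: norm_divide)
    then have "H (Suc n) j (z / 2) = H n j (z / 2)" for j by (rule Suc.IH)
    then show ?case by (simp only: H_Suc[of "Suc n"] H_Suc[of n i z])
  qed (simp add: H_0 H_Suc dup[symmetric])
  have mono: "H k i z = H n i z" if "norm z < 2 ^ n * r" "n \<le> k" for k n i z
    using that(2)
  proof (induction k rule: dec_induct)
    case (step k)
    have "2 ^ n * r \<le> 2 ^ k * r" using step(1) \<open>0 < r\<close> by simp
    with that(1) step show ?case using \<open>\<And>n i z. norm z < 2 ^ n * r \<Longrightarrow> H (Suc n) i z = H n i z\<close>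
      by fastforce
  qed simp
  have ex: "\<exists>n. norm z < 2 ^ n * r" for z :: complex
    using real_arch_pow[of 2 "norm z / r"] \<open>0 < r\<close> by (auto simp: field_simps)
  define G where "G = (\<lambda>i z. H (LEAST n. norm z < 2 ^ n * r) i z)"
  have G: "G i z = H n i z" if "norm z < 2 ^ n * r" for n i z
    unfolding G_def using mono[of z "LEAST n. norm z < 2 ^ n * r" n i] LeastI[of "\<lambda>n. norm z < 2 ^ n * r", OF that]
      Least_le[of "\<lambda>n. norm z < 2 ^ n * r", OF that] by simp
  show ?thesis
  proof (rule that)
    fix i
    have "G i analytic_on {z}" for z
    proof -
      obtain n where n: "norm z < 2 ^ n * r" using ex by blast
      have "G i holomorphic_on ball 0 (2 ^ n * r)"
        by (rule holomorphic_transform[OF hol]) (simp add: G)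
      with n show ?thesis by (metis analytic_at mem_ball_0 open_ball)
    qed
    then show "G i holomorphic_on UNIV"
      using analytic_imp_holomorphic analytic_on_analytic_at by blast
  next
    fix i z assume "norm (z :: complex) < r"
    then show "G i z = F i z" using G[of z 0 i] by (simp add: H_0)
  qed
qed

subsection \<open>Existence and uniqueness of the Jacobian functions\<close>

lemma nicely_meromorphic_remove_sings:
  assumes "f nicely_meromorphic_on UNIV"
  shows "remove_sings f z = f z"
  using assms unfolding nicely_meromorphic_on_def
  by (metis UNIV_I remove_sings_at_pole remove_sings_eqI)

text \<open>The difference \<open>f - g\<close> may have removable singularities, so the identity
  theorem is applied after \<open>remove_sings\<close>. Then \<open>f\<close> and \<open>g\<close>
  agree near every point, and a nicely meromorphic function is determined at a point by its values
  nearby.\<close>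

lemma nicely_meromorphic_unique:
  assumes f: "f nicely_meromorphic_on UNIV" and g: "g nicely_meromorphic_on UNIV"
    and eq: "eventually (\<lambda>z. f z = g z) (at z0)"
  shows "f = g"
proof
  fix z
  have mero: "(\<lambda>z. f z - g z) meromorphic_on UNIV"
    using f g by (intro meromorphic_intros) (auto simp: nicely_meromorphic_on_def)
  have iso: "isolated_singularity_at (\<lambda>z. f z - g z) w" for w
    by (rule meromorphic_on_isolated_singularity[OF meromorphic_on_subset[OF mero]]) simp
  have "eventually (\<lambda>z. remove_sings (\<lambda>z. f z - g z) z = 0) (at z0)"
    using eq eventually_remove_sings_eq_at[OF iso] by eventually_elim simp
  then have "remove_sings (\<lambda>z. f z - g z) w = 0" for w
    by (intro frequently_eq_meromorphic_imp_constant[OF eventually_frequently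
          remove_sings_nicely_meromorphic[OF mero]]) auto
  then have "eventually (\<lambda>w. f w = g w) (at z)"
    using eventually_remove_sings_eq_at[OF iso[of z]] by (auto elim!: eventually_mono)
  then have "remove_sings f z = remove_sings g z"
    by (rule remove_sings_cong) simp
  then show "f z = g z"
    using f g by (simp add: nicely_meromorphic_remove_sings)
qed

text \<open>Analyticity at 0 excludes poles nearby, so the differential equations, demanded only off
  the poles, hold in a full neighbourhood of 0.\<close>

lemma jacobi_system_fps:
  assumes "jacobi_system m s c d"
  shows "s has_fps_expansion Abs_fps (sn_coeff (-1) (-m))" "c has_fps_expansion Abs_fps (cn_coeff (-1) (-m))"
    "d has_fps_expansion Abs_fps (dn_coeff (-1) (-m))"
proof -
  have J: "s analytic_on {0}" "c analytic_on {0}" "d analytic_on {0}" "s 0 = 0" "c 0 = 1" "d 0 = 1"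
    using assms by (simp_all add: jacobi_system_def)
  have np: "eventually (\<lambda>z. \<not> is_pole f z) (nhds 0)" if f: "f analytic_on {0}" for f :: "complex \<Rightarrow> complex"
  proof -
    obtain A where A: "open A" "0 \<in> A" "f holomorphic_on A" using f by (auto simp: analytic_at)
    from eventually_nhds_in_open[OF A(1,2)] show ?thesis
      by eventually_elim (rule not_is_pole_holomorphic[OF A(1) _ A(3)])
  qed
  have "eventually (\<lambda>z. (s has_field_derivative c z * d z) (at z) \<and>
      (c has_field_derivative (-1) * (s z * d z)) (at z) \<and>
      (d has_field_derivative (-m) * (s z * c z)) (at z)) (nhds 0)"
    using np[OF J(1)] np[OF J(2)] np[OF J(3)]
    by eventually_elim (use assms in \<open>simp add: jacobi_system_def mult.assoc\<close>)
  then have "eventually (\<lambda>z. (s has_field_derivative c z * d z) (at z)) (nhds 0)"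
    "eventually (\<lambda>z. (c has_field_derivative (-1) * (s z * d z)) (at z)) (nhds 0)"
    "eventually (\<lambda>z. (d has_field_derivative (-m) * (s z * c z)) (at z)) (nhds 0)"
    by (auto elim: eventually_mono)
  from has_fps_expansion_coeff[OF J this]
  show "s has_fps_expansion Abs_fps (sn_coeff (-1) (-m))" "c has_fps_expansion Abs_fps (cn_coeff (-1) (-m))"
    "d has_fps_expansion Abs_fps (dn_coeff (-1) (-m))" .
qed

lemma jacobi_system_unique:
  assumes J: "jacobi_system m s c d" and J': "jacobi_system m s' c' d'"
  shows "s = s'" "c = c'" "d = d'"
proof -
  have eq: "f = g" if "f nicely_meromorphic_on UNIV" "g nicely_meromorphic_on UNIV"
    "f has_fps_expansion F" "g has_fps_expansion F" for f g :: "complex \<Rightarrow> complex" and F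
  proof (rule nicely_meromorphic_unique[OF that(1,2)])
    have "eventually (\<lambda>z. eval_fps F z = f z) (nhds 0)" "eventually (\<lambda>z. eval_fps F z = g z) (nhds 0)"
      using that(3,4) by (simp_all add: has_fps_expansion_def)
    then have "eventually (\<lambda>z. f z = g z) (nhds 0)"
      by eventually_elim simp
    then show "eventually (\<lambda>z. f z = g z) (at 0)"
      by (auto simp: eventually_at_filter elim: eventually_mono)
  qed
  show "s = s'" "c = c'" "d = d'"
    using J J' eq jacobi_system_fps[OF J] jacobi_system_fps[OF J'] unfolding jacobi_system_def by blast+
qed

text \<open>\<open>deriv f\<close> and \<open>g\<close> are continuous at \<open>z\<close> and agree
  nearby. This serves at zeros of the denominator where the quotients nevertheless stay
  finite.\<close>

lemma DERIV_punctured_imp: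
  fixes f g :: "complex \<Rightarrow> complex"
  assumes "f analytic_on {z}" "g analytic_on {z}"
    and "eventually (\<lambda>w. (f has_field_derivative g w) (at w)) (at z)"
  shows "(f has_field_derivative g z) (at z)"
proof -
  have "isCont (deriv f) z" "isCont g z"
    using assms by (auto intro: analytic_at_imp_isCont analytic_deriv)
  then have "(deriv f \<longlongrightarrow> deriv f z) (at z)" "(g \<longlongrightarrow> g z) (at z)"
    by (simp_all add: isCont_def)
  moreover have "eventually (\<lambda>w. deriv f w = g w) (at z)"
    using assms(3) by eventually_elim (rule DERIV_imp_deriv)
  ultimately have "deriv f z = g z"
    using tendsto_cong tendsto_unique[OF at_neq_bot] by metis
  moreover have "(f has_field_derivative deriv f z) (at z)"
    using analytic_on_imp_differentiable_at[OF assms(1)]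
    by (simp add: DERIV_deriv_iff_field_differentiable)
  ultimately show ?thesis by simp
qed

text \<open>The products of the local solutions with theta, and theta itself, extend to entire
  functions; their quotients are the meromorphic solution.\<close>

lemma jacobi_system_exists:
  fixes m :: complex
  assumes "norm m \<le> 1"
  obtains s c d where "jacobi_system m s c d"
    "\<And>z. norm z < pi / 2 \<Longrightarrow> s z = gsn (-1) (-m) z"
    "\<And>z. norm z < pi / 2 \<Longrightarrow> c z = gcn (-1) (-m) z"
    "\<And>z. norm z < pi / 2 \<Longrightarrow> d z = gdn (-1) (-m) z"
proof -
  have m: "norm (-1 :: complex) \<le> 1" "norm (- m) \<le> 1" using assms by simp_all
  define B where "B = ball (0 :: complex) (pi / 2)"
  define s c d where "s = gsn (-1) (-m)" and "c = gcn (-1) (-m)" and "d = gdn (-1) (-m)"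
  obtain \<Theta> :: "complex \<Rightarrow> complex" where \<Theta>: "\<Theta> holomorphic_on B" "\<Theta> 0 = 1" "\<And>z. \<Theta> z \<noteq> 0"
    "\<And>z. norm z < pi / 2 \<Longrightarrow> \<Theta> z = \<Theta> (z / 2) ^ 4 * (1 - m * s (z / 2) ^ 4)"
    using theta_exists[OF assms] unfolding B_def s_def by blast
  have hol: "s holomorphic_on B" "c holomorphic_on B" "d holomorphic_on B"
    unfolding s_def c_def d_def B_def by (rule g_holomorphic[OF m])+
  \<comment> \<open>Indices 0, 1, 2 are the numerators of sn, cn, dn. Every other index gives the
    denominator, with 3 as its representative.\<close>
  define F :: "nat \<Rightarrow> complex \<Rightarrow> complex" where
    "F = (\<lambda>i z. (if i = 0 then s z else if i = 1 then c z else if i = 2 then d z else 1) * \<Theta> z)"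
  \<comment> \<open>Numerators and denominator of the duplication formulas, made homogeneous of
    degree 4 so that \<open>\<Theta> (z / 2) ^ 4\<close> factors out.\<close>
  define P :: "nat \<Rightarrow> (nat \<Rightarrow> complex) \<Rightarrow> complex" where
    "P = (\<lambda>i x. if i = 0 then 2 * x 0 * x 1 * x 2 * x 3 else if i = 1 then (x 1 * x 3)\<^sup>2 - (x 0 * x 2)\<^sup>2
      else if i = 2 then (x 2 * x 3)\<^sup>2 - m * (x 0 * x 1)\<^sup>2 else x 3 ^ 4 - m * x 0 ^ 4)"
  obtain G where G: "\<And>i. G i holomorphic_on UNIV" "\<And>i z. norm z < pi / 2 \<Longrightarrow> G i z = F i z"
  proof (rule entire_extension[of "pi / 2" F P])
    show "F i holomorphic_on ball 0 (pi / 2)" for i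
      using hol \<Theta>(1) unfolding F_def B_def
      by (cases "i = 0"; cases "i = 1"; cases "i = 2"; auto intro!: holomorphic_intros)
    show "(\<lambda>z. P i (\<lambda>j. H j z)) holomorphic_on A" if "\<And>j. H j holomorphic_on A" for H A i
      unfolding P_def
      by (cases "i = 0"; cases "i = 1"; cases "i = 2"; auto intro!: holomorphic_intros that)
    show "F i z = P i (\<lambda>j. F j (z / 2))" if z: "norm z < pi / 2" for i z
    proof -
      define S C D T where "S = s (z / 2)" and "C = c (z / 2)" and "D = d (z / 2)" and "T = \<Theta> (z / 2)"
      have Q: "1 - m * S ^ 4 \<noteq> 0"
        using one_minus_quartic_nonzero[OF assms z] by (simp add: S_def s_def)
      have "s z = 2 * S * C * D / (1 - m * S ^ 4)" "c z = (C\<^sup>2 - S\<^sup>2 * D\<^sup>2) / (1 - m * S ^ 4)"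
        "d z = (D\<^sup>2 - m * S\<^sup>2 * C\<^sup>2) / (1 - m * S ^ 4)"
        using g_duplication[OF assms z] by (simp_all add: S_def C_def D_def s_def c_def d_def)
      moreover have "\<Theta> z = T ^ 4 * (1 - m * S ^ 4)"
        using \<Theta>(4)[OF z] by (simp add: T_def S_def)
      ultimately have e: "F 0 z = 2 * S * C * D * T ^ 4" "F 1 z = (C\<^sup>2 - S\<^sup>2 * D\<^sup>2) * T ^ 4"
        "F 2 z = (D\<^sup>2 - m * S\<^sup>2 * C\<^sup>2) * T ^ 4"
        "\<And>i. i \<notin> {0, 1, 2} \<Longrightarrow> F i z = T ^ 4 * (1 - m * S ^ 4)"
        using Q by (simp_all add: F_def)
      have v: "F 0 (z / 2) = S * T" "F 1 (z / 2) = C * T" "F 2 (z / 2) = D * T" "F 3 (z / 2) = T"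
        by (simp_all add: F_def S_def C_def D_def T_def)
      consider "i = 0" | "i = 1" | "i = 2" | "i \<notin> {0, 1, 2}" by blast
      then show ?thesis
      proof cases
        case 1
        show ?thesis
          unfolding 1 e(1) P_def v by (simp add: power4_eq_xxxx)
      next
        case 2
        have "F 1 z = (C * T * T)\<^sup>2 - (S * T * (D * T))\<^sup>2"
          unfolding e(2) by (simp add: power2_eq_square power4_eq_xxxx algebra_simps)
        then show ?thesis
          unfolding 2 P_def v by simp
      next
        case 3
        have "F 2 z = (D * T * T)\<^sup>2 - m * (S * T * (C * T))\<^sup>2"
          unfolding e(3) by (simp add: power2_eq_square power4_eq_xxxx algebra_simps)
        then show ?thesis
          unfolding 3 P_def v by simp
      next
        case 4
        have "F i z = T ^ 4 - m * (S * T) ^ 4"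
          unfolding e(4)[OF 4] by (simp add: power_mult_distrib right_diff_distrib)
        then show ?thesis
          unfolding P_def v using 4 by simp
      qed
    qed
  qed auto
  define S C D N where "S = G 0" and "C = G 1" and "D = G 2" and "N = G 3"
  have hol': "S holomorphic_on UNIV" "C holomorphic_on UNIV" "D holomorphic_on UNIV" "N holomorphic_on UNIV"
    unfolding S_def C_def D_def N_def by (rule G)+
  have on_B: "S z = s z * N z" "C z = c z * N z" "D z = d z * N z" "N z = \<Theta> z" if "norm z < pi / 2" for z
    using G(2)[OF that] by (simp_all add: S_def C_def D_def N_def F_def)
  have dS: "(f has_field_derivative deriv f z) (at z)" if "f holomorphic_on UNIV" for f and z :: complex
    using that by (rule holomorphic_derivI) auto
  \<comment> \<open>The quotient rule for \<open>f / N\<close> without division: if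
    \<open>f = p * N\<close> and \<open>p' = q\<close>, the left side is
    \<open>q * N\<^sup>2\<close>. Both sides are entire, so it suffices to check this on
    \<open>B\<close>.\<close>
  have wronski: "deriv f z * N z - f z * deriv N z = g z"
    if "f holomorphic_on UNIV" "g holomorphic_on UNIV"
      "\<And>z. norm z < pi / 2 \<Longrightarrow> f z = p z * N z"
      "\<And>z. norm z < pi / 2 \<Longrightarrow> (p has_field_derivative q z) (at z)"
      "\<And>z. norm z < pi / 2 \<Longrightarrow> g z = q z * (N z)\<^sup>2"
    for f g p q z
  proof (rule analytic_continuation_open[of B UNIV "\<lambda>z. deriv f z * N z - f z * deriv N z" g])
    show "(\<lambda>z. deriv f z * N z - f z * deriv N z) holomorphic_on UNIV"
      by (intro holomorphic_intros that(1) hol'(4)) auto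
    fix z assume z: "z \<in> B"
    then have zn: "norm z < pi / 2" by (simp only: B_def mem_ball_0)
    have "((\<lambda>z. p z * N z) has_field_derivative (q z * N z + deriv N z * p z)) (at z)"
      by (rule DERIV_mult[OF that(4)[OF zn] dS[OF hol'(4)]])
    moreover have "eventually (\<lambda>w. w \<in> B) (nhds z)"
      using z by (intro eventually_nhds_in_open) (auto simp: B_def)
    then have "eventually (\<lambda>w. p w * N w = f w) (nhds z)"
      by eventually_elim (simp only: B_def mem_ball_0 that(3))
    ultimately have "(f has_field_derivative (q z * N z + deriv N z * p z)) (at z)"
      using DERIV_cong_ev[of z z "\<lambda>z. p z * N z" f] by simp
    then have "deriv f z = q z * N z + deriv N z * p z" by (rule DERIV_imp_deriv)
    then show "deriv f z * N z - f z * deriv N z = g z"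
      using that(3,5)[OF zn] by (simp add: algebra_simps power2_eq_square)
  qed (use that(2) in \<open>simp_all add: B_def not_le connected_UNIV\<close>)
  have der: "(s has_field_derivative c z * d z) (at z)" "(c has_field_derivative -1 * (s z * d z)) (at z)"
    "(d has_field_derivative - m * (s z * c z)) (at z)" if "norm z < pi / 2" for z
    unfolding s_def c_def d_def by (rule g_deriv[OF m that])+
  have W1: "deriv S z * N z - S z * deriv N z = C z * D z" for z
  proof (rule wronski[of S "\<lambda>z. C z * D z" s "\<lambda>z. c z * d z"])
    show "S holomorphic_on UNIV" "(\<lambda>z. C z * D z) holomorphic_on UNIV"
      by (intro holomorphic_intros hol')+
    fix z :: complex assume z: "norm z < pi / 2"
    show "S z = s z * N z" by (rule on_B(1)[OF z])
    show "(s has_field_derivative c z * d z) (at z)" by (rule der(1)[OF z])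
    show "C z * D z = c z * d z * (N z)\<^sup>2"
      unfolding on_B(2,3)[OF z] by (simp add: power2_eq_square)
  qed
  have W2: "deriv C z * N z - C z * deriv N z = - (S z * D z)" for z
  proof (rule wronski[of C "\<lambda>z. - (S z * D z)" c "\<lambda>z. -1 * (s z * d z)"])
    show "C holomorphic_on UNIV" "(\<lambda>z. - (S z * D z)) holomorphic_on UNIV"
      by (intro holomorphic_intros hol')+
    fix z :: complex assume z: "norm z < pi / 2"
    show "C z = c z * N z" by (rule on_B(2)[OF z])
    show "(c has_field_derivative -1 * (s z * d z)) (at z)" by (rule der(2)[OF z])
    show "- (S z * D z) = -1 * (s z * d z) * (N z)\<^sup>2"
      unfolding on_B(1,3)[OF z] by (simp add: power2_eq_square)
  qed
  have W3: "deriv D z * N z - D z * deriv N z = - (m * S z * C z)" for z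
  proof (rule wronski[of D "\<lambda>z. - (m * S z * C z)" d "\<lambda>z. - m * (s z * c z)"])
    show "D holomorphic_on UNIV" "(\<lambda>z. - (m * S z * C z)) holomorphic_on UNIV"
      by (intro holomorphic_intros hol')+
    fix z :: complex assume z: "norm z < pi / 2"
    show "D z = d z * N z" by (rule on_B(3)[OF z])
    show "(d has_field_derivative - m * (s z * c z)) (at z)" by (rule der(3)[OF z])
    show "- (m * S z * C z) = - m * (s z * c z) * (N z)\<^sup>2"
      unfolding on_B(1,2)[OF z] by (simp add: power2_eq_square)
  qed

  \<comment> \<open>\<open>remove_sings\<close> fills in the removable singularities at common zeros
    and puts 0 at poles, which is the required representative of the quotient.\<close>
  define q where "q = (\<lambda>f. remove_sings (\<lambda>z. f z / N z))"
  have nice: "q f nicely_meromorphic_on UNIV" if "f holomorphic_on UNIV" for f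
    unfolding q_def using that hol'
    by (intro remove_sings_nicely_meromorphic meromorphic_on_divide analytic_on_imp_meromorphic_on)
      (auto simp: analytic_on_open)
  have q_eq: "q f z = f z / N z" if "f holomorphic_on UNIV" "N z \<noteq> 0" for f z
    unfolding q_def using that hol'
    by (intro remove_sings_at_analytic analytic_on_divide) (auto intro: holomorphic_on_imp_analytic_at)
  have open_U: "open {z. N z \<noteq> 0}"
  proof -
    have "continuous_on UNIV N" using hol'(4) by (rule holomorphic_on_imp_continuous_on)
    then show ?thesis by (intro open_Collect_neq) auto
  qed
  have q_deriv: "(q f has_field_derivative g z / (N z)\<^sup>2) (at z)"
    if "f holomorphic_on UNIV" "N z \<noteq> 0" "deriv f z * N z - f z * deriv N z = g z" for f g z
  proof -
    have "((\<lambda>z. f z / N z) has_field_derivative g z / (N z)\<^sup>2) (at z)"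
      using DERIV_divide[OF dS[OF that(1)] dS[OF hol'(4)] that(2)] that(3)
      by (simp add: power2_eq_square)
    moreover have "eventually (\<lambda>w. w \<in> {z. N z \<noteq> 0}) (nhds z)"
      using that by (intro eventually_nhds_in_open open_U) auto
    then have "eventually (\<lambda>w. f w / N w = q f w) (nhds z)"
      by eventually_elim (simp add: q_eq that)
    ultimately show ?thesis using DERIV_cong_ev[of z z "\<lambda>z. f z / N z" "q f"] by simp
  qed
  have ode_U: "(q S has_field_derivative q C z * q D z) (at z)" 
    "(q C has_field_derivative - (q S z * q D z)) (at z)"
    "(q D has_field_derivative - (m * q S z * q C z)) (at z)" if "N z \<noteq> 0" for z
    using q_deriv[of S z "\<lambda>z. C z * D z", OF hol'(1) that W1]
      q_deriv[of C z "\<lambda>z. - (S z * D z)", OF hol'(2) that W2]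
      q_deriv[of D z "\<lambda>z. - (m * S z * C z)", OF hol'(3) that W3]
    by (simp_all add: q_eq hol' that power2_eq_square)
  have N0: "N z \<noteq> 0" if "norm z < pi / 2" for z
    using on_B(4)[OF that] \<Theta>(3) by simp
  \<comment> \<open>\<open>N\<close> is entire and not identically zero, so its zeros are
    isolated.\<close>
  have ev_U: "eventually (\<lambda>w. N w \<noteq> 0) (at z)" for z
    using non_zero_neighbour_alt[OF hol'(4), of z 0] N0[of 0] by (auto elim: eventually_mono)
  have q_B: "q S z = s z" "q C z = c z" "q D z = d z" if "norm z < pi / 2" for z
    using N0[OF that] on_B(1-3)[OF that] by (simp_all add: q_eq hol')
  have an_U: "q f analytic_on {z}" if "f holomorphic_on UNIV" "N z \<noteq> 0" for f z
  proof -
    have "q f holomorphic_on {z. N z \<noteq> 0}"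
      using q_deriv[OF that(1), where g = "\<lambda>z. deriv f z * N z - f z * deriv N z"] open_U by (subst holomorphic_on_open) auto
    with open_U that show ?thesis by (auto simp: analytic_at)
  qed
  have "jacobi_system m (q S) (q C) (q D)"
    unfolding jacobi_system_def
  proof (intro conjI allI impI)
    show "q S nicely_meromorphic_on UNIV" "q C nicely_meromorphic_on UNIV" "q D nicely_meromorphic_on UNIV"
      by (rule nice hol')+
    show "q S analytic_on {0}" "q C analytic_on {0}" "q D analytic_on {0}"
      using an_U[of _ 0] hol' N0[of 0] by simp_all
    show "q S 0 = 0" "q C 0 = 1" "q D 0 = 1"
      using q_B[of 0] by (simp_all add: s_def c_def d_def)
  next
    fix z assume "\<not> is_pole (q S) z \<and> \<not> is_pole (q C) z \<and> \<not> is_pole (q D) z"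
    then have an: "q S analytic_on {z}" "q C analytic_on {z}" "q D analytic_on {z}"
      using nice hol' nicely_meromorphic_on_imp_analytic_at by blast+
    show "(q S has_field_derivative q C z * q D z) (at z)"
      by (rule DERIV_punctured_imp[OF an(1) _ eventually_mono[OF ev_U ode_U(1)]])
        (intro analytic_intros an)
    show "(q C has_field_derivative - (q S z * q D z)) (at z)"
      by (rule DERIV_punctured_imp[OF an(2) _ eventually_mono[OF ev_U ode_U(2)]])
        (intro analytic_intros an)
    show "(q D has_field_derivative - (m * q S z * q C z)) (at z)"
      by (rule DERIV_punctured_imp[OF an(3) _ eventually_mono[OF ev_U ode_U(3)]])
        (intro analytic_intros an)
  qed
  with q_B show ?thesis using that by (simp add: s_def c_def d_def)
qed

text \<open>Existence and uniqueness resolve the definite descriptions, so on the disc everything is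
  reduced to the power series, whose holomorphy excludes poles.\<close>

lemma jacobi_eq_g:
  fixes m :: complex
  assumes "norm m \<le> 1" "norm z < pi / 2"
  shows "jacobi_sn z m = gsn (-1) (-m) z" "jacobi_cn z m = gcn (-1) (-m) z" "jacobi_dn z m = gdn (-1) (-m) z"
    "jacobi_finite z m"
proof -
  have m: "norm (-1 :: complex) \<le> 1" "norm (- m) \<le> 1" using assms by simp_all
  obtain s c d where J: "jacobi_system m s c d"
    and B: "\<And>z. norm z < pi / 2 \<Longrightarrow> s z = gsn (-1) (-m) z"
    "\<And>z. norm z < pi / 2 \<Longrightarrow> c z = gcn (-1) (-m) z"
    "\<And>z. norm z < pi / 2 \<Longrightarrow> d z = gdn (-1) (-m) z"
    using jacobi_system_exists[OF assms(1)] by blast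
  have "(THE s. \<exists>c d. jacobi_system m s c d) = s" "(THE c. \<exists>s d. jacobi_system m s c d) = c"
    "(THE d. \<exists>s c. jacobi_system m s c d) = d"
    using J jacobi_system_unique[OF J] by (blast intro: the_equality)+
  then have eq: "jacobi_sn w m = s w" "jacobi_cn w m = c w" "jacobi_dn w m = d w" for w
    by (simp_all add: jacobi_sn_def jacobi_cn_def jacobi_dn_def)
  with assms(2) show "jacobi_sn z m = gsn (-1) (-m) z" "jacobi_cn z m = gcn (-1) (-m) z" 
    "jacobi_dn z m = gdn (-1) (-m) z" by (simp_all only: B)
  have np: "\<not> is_pole f z" if "g holomorphic_on ball 0 (pi / 2)" "\<And>w. norm w < pi / 2 \<Longrightarrow> f w = g w"
    for f g :: "complex \<Rightarrow> complex"
  proof (rule not_is_pole_holomorphic)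
    show "f holomorphic_on ball 0 (pi / 2)"
      by (rule holomorphic_transform[OF that(1)]) (simp only: mem_ball_0 that(2))
  qed (use assms(2) in auto)
  show "jacobi_finite z m"
    unfolding jacobi_finite_def eq
    using np[OF g_holomorphic(1)[OF m] B(1)] np[OF g_holomorphic(2)[OF m] B(2)]
      np[OF g_holomorphic(3)[OF m] B(3)] by blast
qed

subsection \<open>The inequalities\<close>

text \<open>The imaginary transformation at a real argument, with
  \<open>- (1 - \<mu>) = \<mu> - 1\<close>. Here \<open>c\<close> cannot vanish because its product
  with \<open>gcn 1 \<mu> x\<close> is 1.\<close>

lemma jacobi_quotients:
  assumes "0 \<le> \<mu>" "\<mu> \<le> 1" "\<bar>x\<bar> < pi / 2"
  defines "s \<equiv> jacobi_sn (of_real x) (of_real (1 - \<mu>))" and "c \<equiv> jacobi_cn (of_real x) (of_real (1 - \<mu>))"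
    and "d \<equiv> jacobi_dn (of_real x) (of_real (1 - \<mu>))"
  shows "c \<noteq> 0" "s / c = of_real (gsn 1 \<mu> x)" "1 / c = of_real (gcn 1 \<mu> x)" "d / c = of_real (gdn 1 \<mu> x)"
proof -
  have n: "norm (complex_of_real \<mu>) \<le> 1" "norm (1 - complex_of_real \<mu>) \<le> 1" "norm (complex_of_real x) < pi / 2"
    using assms norm_of_real[of "1 - \<mu>", where 'a = complex] by simp_all
  have "norm (complex_of_real (1 - \<mu>)) \<le> 1" using n(2) by simp
  note e = jacobi_eq_g[OF this n(3)]
  note i = g_imaginary_transformation[OF n] g_of_real[of 1 \<mu> x]
  have r: "s * of_real (gcn 1 \<mu> x) = of_real (gsn 1 \<mu> x)" "c * of_real (gcn 1 \<mu> x) = 1"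
    "d * of_real (gcn 1 \<mu> x) = of_real (gdn 1 \<mu> x)"
    using i assms(1-3) e unfolding s_def c_def d_def by simp_all
  then show "c \<noteq> 0" by auto
  with r(2) show c: "1 / c = of_real (gcn 1 \<mu> x)" by (simp add: field_simps)
  show "s / c = of_real (gsn 1 \<mu> x)" "d / c = of_real (gdn 1 \<mu> x)"
    unfolding r(1,3)[symmetric] c[symmetric] by simp_all
qed

text \<open>Since \<open>w\<^sup>2 = -1\<close>, \<open>g_scale\<close> turns
  \<open>(-1, -\<mu>)\<close> into \<open>(1, \<mu>)\<close> at the cost of a factor of modulus 1.
  Allowing both square roots covers both halves of the imaginary axis with \<open>x\<close>
  nonnegative.\<close>

lemma norm_jacobi_imaginary:
  fixes w :: complex
  assumes "w\<^sup>2 = -1" "0 \<le> \<mu>" "\<mu> \<le> 1" "0 \<le> x" "x < pi / 2"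
  shows "norm (jacobi_sn (w * of_real x) (of_real \<mu>)) = gsn 1 \<mu> x"
    "norm (jacobi_cn (w * of_real x) (of_real \<mu>)) = gcn 1 \<mu> x"
    "norm (jacobi_dn (w * of_real x) (of_real \<mu>)) = gdn 1 \<mu> x"
proof -
  have "norm w ^ 2 = 1" using assms(1) by (simp flip: norm_power)
  then have w: "norm w = 1" by (simp add: power2_eq_1_iff) (use norm_ge_zero[of w] in linarith)
  have \<mu>: "norm (complex_of_real \<mu>) \<le> 1" "norm (- complex_of_real \<mu>) \<le> 1" "norm (-1 :: complex) \<le> 1"
    using assms by simp_all
  have x: "norm (complex_of_real x) < pi / 2" "norm (w * of_real x) < pi / 2"
    using assms w by (simp_all add: norm_mult)
  \<comment> \<open>Nonnegativity makes the norms of these real values equal to the values.\<close>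
  have real: "0 \<le> gsn 1 \<mu> x" "0 \<le> gcn 1 \<mu> x" "0 \<le> gdn 1 \<mu> x"
    using g_norm_le[of "1::real" 1 \<mu> \<mu> x] assms by (auto intro: order_trans[OF norm_ge_zero])
  have [simp]: "gsn 1 (complex_of_real \<mu>) (complex_of_real x) = of_real (gsn 1 \<mu> x)"
    "gcn 1 (complex_of_real \<mu>) (complex_of_real x) = of_real (gcn 1 \<mu> x)"
    "gdn 1 (complex_of_real \<mu>) (complex_of_real x) = of_real (gdn 1 \<mu> x)"
    using g_of_real[of 1 \<mu> x] assms by simp_all
  show "norm (jacobi_sn (w * of_real x) (of_real \<mu>)) = gsn 1 \<mu> x"
    "norm (jacobi_cn (w * of_real x) (of_real \<mu>)) = gcn 1 \<mu> x"
    "norm (jacobi_dn (w * of_real x) (of_real \<mu>)) = gdn 1 \<mu> x"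
    unfolding jacobi_eq_g[OF \<mu>(1) x(2)] g_scale[OF w \<mu>(3,2) x(1)] assms(1)
    using real w by (simp_all add: norm_mult)
qed

lemma norm_jacobi_le:
  fixes m z :: complex
  assumes "norm m \<le> 1" "norm z < pi / 2"
  shows "norm (jacobi_sn z m) \<le> gsn 1 (norm m) (norm z)" "norm (jacobi_cn z m) \<le> gcn 1 (norm m) (norm z)"
    "norm (jacobi_dn z m) \<le> gdn 1 (norm m) (norm z)"
  unfolding jacobi_eq_g[OF assms] by (rule g_norm_le; use assms in simp)+

lemma g_1_le:
  assumes "0 \<le> \<mu>" "\<mu> \<le> 1" "0 \<le> x" "x < pi / 2"
  shows "gsn 1 \<mu> x \<le> tan x" "gcn 1 \<mu> x \<le> 1 / cos x" "gdn 1 \<mu> x \<le> 1 / cos x"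
  using g_norm_le[of "1::real" 1 \<mu> 1 x] g_1_1[of x] assms by auto

(* On complex numbers a \<le> b means Re a \<le> Re b and Im a = Im b, so the inequalities include that
   the quotients sn/cn, 1/cn and dn/cn at the real arguments are real. *)
theorem theorem1:
  fixes R m1 :: real and m z :: complex
  assumes "R < pi / 2" and "cmod m \<le> 1" and "cmod z \<le> R" and "m1 = 1 - cmod m"
  shows
    "let sn1 = jacobi_sn (complex_of_real (cmod z)) (complex_of_real m1);
         cn1 = jacobi_cn (complex_of_real (cmod z)) (complex_of_real m1);
         dn1 = jacobi_dn (complex_of_real (cmod z)) (complex_of_real m1)
     in
       m1 \<in> {0..1} \<and>
       jacobi_finite z m \<and>
       jacobi_finite (complex_of_real (cmod z)) (complex_of_real m1) \<and> cn1 \<noteq> 0 \<and>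
       complex_of_real (cmod (jacobi_sn z m)) \<le> sn1 / cn1 \<and>
       sn1 / cn1 \<le> complex_of_real (tan (cmod z)) \<and>
       complex_of_real (cmod (jacobi_cn z m)) \<le> 1 / cn1 \<and>
       1 / cn1 \<le> complex_of_real (1 / cos (cmod z)) \<and>
       complex_of_real (cmod (jacobi_dn z m)) \<le> dn1 / cn1 \<and>
       dn1 / cn1 \<le> complex_of_real (1 / cos (cmod z)) \<and>
       (z = 0 \<or> (m = 1 \<and> (\<exists>y::real. - R \<le> y \<and> y \<le> R \<and> z = \<i> * complex_of_real y)) \<longrightarrow>
          complex_of_real (cmod (jacobi_sn z m)) = sn1 / cn1 \<and>
          sn1 / cn1 = complex_of_real (tan (cmod z)) \<and>
          complex_of_real (cmod (jacobi_cn z m)) = 1 / cn1 \<and>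
          1 / cn1 = complex_of_real (1 / cos (cmod z)) \<and>
          complex_of_real (cmod (jacobi_dn z m)) = dn1 / cn1 \<and>
          dn1 / cn1 = complex_of_real (1 / cos (cmod z))) \<and>
       ((\<exists>y::real. - R \<le> y \<and> y \<le> R \<and> z = \<i> * complex_of_real y) \<and>
          m = complex_of_real (cmod m) \<longrightarrow>
          complex_of_real (cmod (jacobi_sn z m)) = sn1 / cn1 \<and>
          complex_of_real (cmod (jacobi_cn z m)) = 1 / cn1 \<and>
          complex_of_real (cmod (jacobi_dn z m)) = dn1 / cn1)"
proof -
  have z: "cmod z < pi / 2" "\<bar>cmod z\<bar> < pi / 2" "cmod (complex_of_real (cmod z)) < pi / 2"
    using assms by simp_all
  have m1: "cmod (complex_of_real (1 - cmod m)) \<le> 1"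
    using assms(2) norm_of_real[of "1 - cmod m", where 'a = complex] by simp
  have imag: "norm (jacobi_sn z m) = gsn 1 (cmod m) (cmod z) \<and>
      norm (jacobi_cn z m) = gcn 1 (cmod m) (cmod z) \<and> norm (jacobi_dn z m) = gdn 1 (cmod m) (cmod z)"
    if "z = \<i> * complex_of_real y" "m = complex_of_real (cmod m)" for y
  proof -
    \<comment> \<open>The sign of \<open>y\<close> selects the square root of -1 for which
      \<open>z\<close> is \<open>w\<close> times its own modulus.\<close>
    define w where "w = (if 0 \<le> y then \<i> else - \<i>)"
    have "w\<^sup>2 = -1" "z = w * of_real (cmod z)"
      by (simp_all add: w_def that(1) norm_mult)
    then show ?thesis
      using norm_jacobi_imaginary[of w "cmod m" "cmod z"] z assms(2) that(2) by simp
  qed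
  have zero: "norm (jacobi_sn z m) = gsn 1 (cmod m) (cmod z) \<and>
      norm (jacobi_cn z m) = gcn 1 (cmod m) (cmod z) \<and> norm (jacobi_dn z m) = gdn 1 (cmod m) (cmod z)"
    if "z = 0"
    using jacobi_eq_g[OF assms(2) z(1)] that by simp
  have sharp: "gsn 1 (cmod m) (cmod z) = tan (cmod z) \<and> gcn 1 (cmod m) (cmod z) = 1 / cos (cmod z) \<and>
      gdn 1 (cmod m) (cmod z) = 1 / cos (cmod z)" if "z = 0 \<or> m = 1"
    using that g_1_1[OF z(2)] by auto
  \<comment> \<open>With \<open>\<mu> = cmod m\<close> the three quotients become real values of
    \<open>gsn\<close>, \<open>gcn\<close>, \<open>gdn\<close>, so every claim reduces to the real
    bounds and equalities above.\<close>
  note J = jacobi_quotients[OF norm_ge_zero assms(2) z(2)]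
  show ?thesis
    unfolding Let_def assms(4) J(2,3,4) of_real_eq_iff less_eq_complex_def
    using J(1) jacobi_eq_g(4)[OF assms(2) z(1)] jacobi_eq_g(4)[OF m1 z(3)] norm_jacobi_le[OF assms(2) z(1)]
      g_1_le[OF norm_ge_zero assms(2) norm_ge_zero z(1)] imag zero sharp assms(2)
    by (auto simp del: of_real_diff)
qed

end
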